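(* Suppose $G$ is a hyperbolic group, $H$ is a subgroup of $G$ and $Q$ is a finite union of quasiconvex products in $G$ with members $F_1,\dots,F_l$. Assume also that $|H:(H\cap gF_jg^{-1})|=\infty$ for every $g\in G$ and every $j=1,2,\dots,l$. Then for arbitrary two finite subsets $P_1,P_2\subset G$, the subgroup $H$ is not contained in $P_1\cdot Q^{-1}\cdot Q\cdot P_2$.
   Context: Hyperbolic means Gromov (word) hyperbolic. Fix a finite symmetrized generating set of $G$. A subset of $G$ is quasiconvex if for some $\eta\ge0$ every geodesic segment in the Cayley graph joining two elements of the subset lies in the closed $\eta$-neighborhood of the subset (in a hyperbolic group this does not depend on the generating set). Products of subsets are taken elementwise, $Q^{-1}=\{q^{-1}\mid q\in Q\}$. If $F_1,\dots,F_n$ are quasiconvex subgroups of $G$ and $g_0,g_1,\dots,g_n\in G$, the subset $P=g_0F_1\cdot\ldots\cdot g_{n-1}F_ng_n=\{g_0f_1\cdot\ldots\cdot g_{n-1}f_ng_n\mid f_i\in F_i,\ i=1,\dots,n\}$ is called a quasiconvex product, and the subgroups $F_1,\dots,F_n$ are its members. For a finite union $U=\bigcup_{k=1}^N P_k$ of quasiconvex products $P_k$, a subgroup $F\le G$ is a member of $U$ if it is a member of $P_k$ for some $1\le k\le N$; for any such $U$ one fixes a representation as a finite union of quasiconvex products, and with it the members. Here $F_1,\dots,F_l$ are all the members of $Q$. *)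

theory Defs
  imports "HOL-Algebra.Coset" "HOL-Algebra.Generated_Groups" Complex_Main
begin

definition symmetric_generating_set :: "('a, 'b) monoid_scheme \<Rightarrow> 'a set \<Rightarrow> bool" where
  "symmetric_generating_set G S \<longleftrightarrow>
     finite S \<and> S \<subseteq> carrier G \<and> (\<forall>s\<in>S. inv\<^bsub>G\<^esub> s \<in> S) \<and> generate G S = carrier G"

text \<open>If \<open>S\<close> contains the unit, the relation below has loops; they never occur on a
  walk of minimal length.\<close>

definition cayley_adj :: "('a, 'b) monoid_scheme \<Rightarrow> 'a set \<Rightarrow> 'a \<Rightarrow> 'a \<Rightarrow> bool" where
  "cayley_adj G S x y \<longleftrightarrow> (\<exists>s\<in>S. y = x \<otimes>\<^bsub>G\<^esub> s)"

definition cayley_walk ::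
    "('a, 'b) monoid_scheme \<Rightarrow> 'a set \<Rightarrow> 'a \<Rightarrow> 'a list \<Rightarrow> 'a \<Rightarrow> bool" where
  "cayley_walk G S x xs y \<longleftrightarrow>
     xs \<noteq> [] \<and> set xs \<subseteq> carrier G \<and> hd xs = x \<and> last xs = y \<and> successively (cayley_adj G S) xs"

text \<open>A walk is the list of its vertices, so a walk with \<open>n\<close> edges has length \<open>Suc n\<close>.\<close>

definition word_dist :: "('a, 'b) monoid_scheme \<Rightarrow> 'a set \<Rightarrow> 'a \<Rightarrow> 'a \<Rightarrow> nat" where
  "word_dist G S x y = (LEAST n. \<exists>xs. cayley_walk G S x xs y \<and> length xs = Suc n)"

definition cayley_geodesic ::
    "('a, 'b) monoid_scheme \<Rightarrow> 'a set \<Rightarrow> 'a \<Rightarrow> 'a list \<Rightarrow> 'a \<Rightarrow> bool" where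
  "cayley_geodesic G S x xs y \<longleftrightarrow>
     cayley_walk G S x xs y \<and> length xs = Suc (word_dist G S x y)"

definition gromov_product ::
    "('a, 'b) monoid_scheme \<Rightarrow> 'a set \<Rightarrow> 'a \<Rightarrow> 'a \<Rightarrow> 'a \<Rightarrow> real" where
  "gromov_product G S w x y =
     (real (word_dist G S x w) + real (word_dist G S y w) - real (word_dist G S x y)) / 2"

text \<open>Gromov's four-point condition for the word metric. Since every point of the Cayley
  graph is within distance 1/2 of a vertex, quantifying over vertices only changes the
  constant \<open>\<delta>\<close>.\<close>

definition hyperbolic_group :: "('a, 'b) monoid_scheme \<Rightarrow> 'a set \<Rightarrow> bool" where
  "hyperbolic_group G S \<longleftrightarrow>
     group G \<and> symmetric_generating_set G S \<and>
     (\<exists>\<delta>\<ge>0. \<forall>w\<in>carrier G. \<forall>x\<in>carrier G. \<forall>y\<in>carrier G. \<forall>z\<in>carrier G.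
        gromov_product G S w x y
          \<ge> min (gromov_product G S w x z) (gromov_product G S w z y) - \<delta>)"

text \<open>A geodesic segment joining two group elements is an edge path; requiring only its
  vertices to lie in the neighbourhood again only changes the constant \<open>\<eta>\<close>.\<close>

definition quasiconvex :: "('a, 'b) monoid_scheme \<Rightarrow> 'a set \<Rightarrow> 'a set \<Rightarrow> bool" where
  "quasiconvex G S A \<longleftrightarrow>
     A \<subseteq> carrier G \<and>
     (\<exists>\<eta>::real. \<eta> \<ge> 0 \<and>
        (\<forall>x\<in>A. \<forall>y\<in>A. \<forall>xs. cayley_geodesic G S x xs y \<longrightarrow>
           (\<forall>p\<in>set xs. \<exists>a\<in>A. real (word_dist G S p a) \<le> \<eta>)))"

text \<open>The expression \<open>g\<^sub>0 F\<^sub>1 g\<^sub>1 \<dots> F\<^sub>n g\<^sub>n\<close> is represented by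
  \<open>(g\<^sub>0, [(F\<^sub>1, g\<^sub>1), \<dots>, (F\<^sub>n, g\<^sub>n)])\<close>. The members depend on this representation,
  not only on the resulting subset. At least one factor is required: otherwise
  a one-point set would be a product without members.\<close>

type_synonym 'a product_rep = "'a \<times> ('a set \<times> 'a) list"

definition is_quasiconvex_product ::
    "('a, 'b) monoid_scheme \<Rightarrow> 'a set \<Rightarrow> 'a product_rep \<Rightarrow> bool" where
  "is_quasiconvex_product G S P \<longleftrightarrow>
     fst P \<in> carrier G \<and> snd P \<noteq> [] \<and>
     (\<forall>(F, g)\<in>set (snd P). subgroup F G \<and> quasiconvex G S F \<and> g \<in> carrier G)"

definition product_set :: "('a, 'b) monoid_scheme \<Rightarrow> 'a product_rep \<Rightarrow> 'a set" where
  "product_set G P = foldl (\<lambda>A (F, g). (A <#>\<^bsub>G\<^esub> F) #>\<^bsub>G\<^esub> g) {fst P} (snd P)"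

definition product_members :: "'a product_rep \<Rightarrow> 'a set set" where
  "product_members P = fst ` set (snd P)"

definition conjugate_set :: "('a, 'b) monoid_scheme \<Rightarrow> 'a \<Rightarrow> 'a set \<Rightarrow> 'a set" where
  "conjugate_set G g F = (g <#\<^bsub>G\<^esub> F) #>\<^bsub>G\<^esub> (inv\<^bsub>G\<^esub> g)"

definition infinite_index :: "('a, 'b) monoid_scheme \<Rightarrow> 'a set \<Rightarrow> 'a set \<Rightarrow> bool" where
  "infinite_index G H K \<longleftrightarrow> infinite (rcosets\<^bsub>G\<lparr>carrier := H\<rparr>\<^esub> K)"

end

theory Submission
  imports Defs
begin

text \<open>The set \<open>P\<^sub>1 Q\<inverse> Q P\<^sub>2\<close> lies in the set of products of a bounded number \<open>n\<close> of factors,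
  each taken from a member or from a fixed ball. A broken line with vertices at the partial products
  shows that a geodesic from \<open>1\<close> to such a product is covered by neighbourhoods of at most
  \<open>n + 1\<close> cosets of members, and quasiconvexity makes each of these pieces coarsely an interval.

  It therefore suffices to find, for a constant \<open>C\<close> and every radius \<open>B\<close>, an element \<open>w \<in> H\<close>
  outside the \<open>B\<close>-neighbourhoods of all cosets \<open>e F\<close> with \<open>|e| \<le> B\<close>, such that the
  Gromov product of \<open>w\<inverse>\<close> and \<open>w\<close> is at most \<open>C\<close>: the powers of \<open>w\<close>
  then form a quasigeodesic, by pigeonhole two of the points \<open>1, w, \<dots>, w\<^sup>n\<^sup>+\<^sup>1\<close> are close to
  the same coset, and so are two consecutive ones, which contradicts the choice of \<open>w\<close>.

  To find \<open>w\<close>, take \<open>g \<in> H\<close> loxodromic. If every element of \<open>H\<close> commensurates \<open>g\<close>,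
  then \<open>\<langle>g\<rangle>\<close> has finite index in \<open>H\<close> and \<open>w\<close> is a power of \<open>g\<close>. Otherwise some
  \<open>t \<in> H\<close> moves both ends of \<open>g\<close> away from both ends, B. H. Neumann's covering lemma
  yields \<open>v \<in> H\<close> avoiding the members, and \<open>w = v g\<^sup>k (t g\<^sup>m t\<inverse>) g\<^sup>l\<close> for
  exponents \<open>k, l\<close> whose signs are chosen so that there is no backtracking.\<close>

section \<open>Covering a subgroup by cosets of finitely many subgroups\<close>

context group
begin

lemma inv_cancel_left [simp]:
  "x \<in> carrier G \<Longrightarrow> y \<in> carrier G \<Longrightarrow> inv x \<otimes> (x \<otimes> y) = y"
  "x \<in> carrier G \<Longrightarrow> y \<in> carrier G \<Longrightarrow> x \<otimes> (inv x \<otimes> y) = y"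
  by (simp_all add: m_assoc[symmetric])

lemma neumann_cover:
  assumes "finite K" "\<And>A. A \<in> K \<Longrightarrow> subgroup A G" "subgroup H G"
    "finite T" "T \<subseteq> carrier G" "H \<subseteq> (\<Union>A\<in>K. A <#> T)"
  shows "\<exists>A\<in>K. \<exists>T'. finite T' \<and> T' \<subseteq> carrier G \<and> H \<subseteq> A <#> T'"
  using assms
proof (induction K arbitrary: T rule: finite_induct)
  case empty
  then show ?case using subgroup.one_closed by fastforce
next
  case (insert A K)
  have A: "subgroup A G" using insert.prems by auto
  have H: "subgroup H G" using insert.prems by auto
  have Hc: "H \<subseteq> carrier G" using H subgroup.subset by blast
  show ?case
  proof (cases "H \<subseteq> A <#> T")
    case True
    then show ?thesis using insert.prems by blast
  next
    case False
    then obtain h where h: "h \<in> H" "h \<notin> A <#> T" by auto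
    \<comment> \<open>\<open>X t\<close> is a representative in \<open>H\<close> of the coset of
      \<open>A\<close> through \<open>t\<close>, meaningful only if that coset meets
      \<open>H\<close>; the pairs in \<open>T'\<close> are restricted accordingly.\<close>
    define X where "X t = (SOME x. x \<in> H \<and> (\<exists>a\<in>A. x = a \<otimes> t))" for t
    define T' where "T' = T \<union> (\<lambda>(s, t). s \<otimes> inv h \<otimes> X t) ` (T \<times> {t \<in> T. \<exists>x\<in>H. \<exists>a\<in>A. x = a \<otimes> t})"
    have X: "X t \<in> H \<and> (\<exists>a\<in>A. X t = a \<otimes> t)" if "\<exists>x\<in>H. \<exists>a\<in>A. x = a \<otimes> t" for t
      using someI_ex[of "\<lambda>x. x \<in> H \<and> (\<exists>a\<in>A. x = a \<otimes> t)"] that unfolding X_def by blast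
    have "finite T'" unfolding T'_def using insert.prems by auto
    moreover have "T' \<subseteq> carrier G" 
    proof -
      have "s \<otimes> inv h \<otimes> X t \<in> carrier G" if "s \<in> T" "\<exists>x\<in>H. \<exists>a\<in>A. x = a \<otimes> t" for s t
        using X[OF that(2)] that(1) Hc h(1) insert.prems(4) by blast
      then show ?thesis unfolding T'_def using insert.prems(4) by auto
    qed
    moreover have "H \<subseteq> (\<Union>B\<in>K. B <#> T')"
    proof
      fix x assume x: "x \<in> H"
      then consider B where "B \<in> K" "x \<in> B <#> T" | "x \<in> A <#> T" using insert.prems by blast
      then show "x \<in> (\<Union>B\<in>K. B <#> T')"
      proof cases
        case 1
        then show ?thesis unfolding T'_def set_mult_def by blast
      next
        case 2
        then obtain a t where at: "a \<in> A" "t \<in> T" "x = a \<otimes> t" unfolding set_mult_def by auto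
        then have ex: "\<exists>x\<in>H. \<exists>a\<in>A. x = a \<otimes> t" using x by auto
        obtain b where b: "b \<in> A" "X t = b \<otimes> t" and XH: "X t \<in> H" using X[OF ex] by auto
        have car: "a \<in> carrier G" "b \<in> carrier G" "t \<in> carrier G" "h \<in> carrier G"
          using at b A insert.prems h Hc subgroup.mem_carrier[OF A] by auto
        \<comment> \<open>This is the translation that moves \<open>x\<close> from the coset of
          \<open>t\<close> to the coset of \<open>h\<close> without leaving
          \<open>H\<close>.\<close>
        define y where "y = x \<otimes> inv (X t) \<otimes> h"
        have y1: "y \<in> H" unfolding y_def using H x XH h
          by (simp add: subgroup.m_closed subgroup.m_inv_closed)
        have y2: "y = (a \<otimes> inv b) \<otimes> h"
          unfolding y_def using at b car by (simp add: m_assoc inv_mult_group)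
        have ab: "a \<otimes> inv b \<in> A" using A at b by (simp add: subgroup.m_closed subgroup.m_inv_closed)
        have "y \<notin> A <#> T"
        proof
          assume "y \<in> A <#> T"
          then obtain c s where c: "c \<in> A" "s \<in> T" "y = c \<otimes> s" unfolding set_mult_def by auto
          then have cs: "c \<in> carrier G" "s \<in> carrier G"
            using subgroup.mem_carrier[OF A] insert.prems by auto
          have "h = inv (a \<otimes> inv b) \<otimes> y" unfolding y2 using car by (simp add: m_assoc inv_mult_group)
          then have "h = (inv (a \<otimes> inv b) \<otimes> c) \<otimes> s" using c cs car by (simp add: m_assoc)
          moreover have "inv (a \<otimes> inv b) \<otimes> c \<in> A"
            using A ab c by (simp add: subgroup.m_closed subgroup.m_inv_closed)
          ultimately show False using h c unfolding set_mult_def by blast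
        qed
        then obtain B where B: "B \<in> K" "y \<in> B <#> T" using y1 insert.prems by blast
        then obtain c s where c: "c \<in> B" "s \<in> T" "y = c \<otimes> s" unfolding set_mult_def by auto
        have cs: "c \<in> carrier G" "s \<in> carrier G" "x \<in> carrier G" "X t \<in> carrier G"
          using c(1) subgroup.mem_carrier[OF insert.prems(1)[of B]] B(1) c(2) insert.prems(4) x XH Hc
          by auto
        have "x = y \<otimes> inv h \<otimes> X t" unfolding y_def using cs car by (simp add: m_assoc)
        then have "x = c \<otimes> (s \<otimes> inv h \<otimes> X t)" using c cs car by (simp add: m_assoc)
        moreover have "s \<otimes> inv h \<otimes> X t \<in> T'" unfolding T'_def using c(2) at(2) ex
          by (intro UnI2 image_eqI[of _ _ "(s, t)"]) auto
        ultimately show ?thesis using B c unfolding set_mult_def by blast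
      qed
    qed
    ultimately show ?thesis using insert.IH[of T'] insert.prems by auto
  qed
qed

end

subsection \<open>Gromov products and loxodromic elements\<close>

text \<open>An abstraction of the word metric. It is real valued because Gromov products are
  half-integers; integrality survives as \<open>d_nat\<close>, and \<open>geod\<close> supplies
  points of a geodesic only at integer distances.\<close>

locale hyp_group = group G for G (structure) +
  fixes d :: "'a \<Rightarrow> 'a \<Rightarrow> real" and \<delta> :: real
  assumes d_refl [simp]: "x \<in> carrier G \<Longrightarrow> d x x = 0"
    and d_nat: "\<exists>n::nat. d x y = real n"
    and d_sym: "x \<in> carrier G \<Longrightarrow> y \<in> carrier G \<Longrightarrow> d x y = d y x"
    and d_tri: "x \<in> carrier G \<Longrightarrow> y \<in> carrier G \<Longrightarrow> z \<in> carrier G \<Longrightarrow> d x z \<le> d x y + d y z"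
    and d_left [simp]: "a \<in> carrier G \<Longrightarrow> x \<in> carrier G \<Longrightarrow> y \<in> carrier G \<Longrightarrow> d (a \<otimes> x) (a \<otimes> y) = d x y"
    and finite_ball: "finite {x \<in> carrier G. d \<one> x \<le> r}"
    and geod: "x \<in> carrier G \<Longrightarrow> y \<in> carrier G \<Longrightarrow> real n \<le> d x y \<Longrightarrow>
       \<exists>p\<in>carrier G. d x p = real n \<and> d p y = d x y - real n"
    and delta_nonneg: "\<delta> \<ge> 0"
    and hyp: "w \<in> carrier G \<Longrightarrow> x \<in> carrier G \<Longrightarrow> y \<in> carrier G \<Longrightarrow> z \<in> carrier G \<Longrightarrow>
       (d w x + d w y - d x y) / 2
         \<ge> min ((d w x + d w z - d x z) / 2) ((d w z + d w y - d z y) / 2) - \<delta>"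
begin

definition gp :: "'a \<Rightarrow> 'a \<Rightarrow> 'a \<Rightarrow> real" where
  "gp z x y = (d z x + d z y - d x y) / 2"

lemma d_nonneg [simp]: "d x y \<ge> 0"
  using d_nat[of x y] by auto

lemma gp_hyp:
  assumes "w \<in> carrier G" "x \<in> carrier G" "y \<in> carrier G" "z \<in> carrier G"
  shows "gp w x y \<ge> gp w x z - \<delta> \<or> gp w x y \<ge> gp w z y - \<delta>"
  using hyp[OF assms] unfolding gp_def min_def by (auto split: if_splits)

lemma gp_sym: "x \<in> carrier G \<Longrightarrow> y \<in> carrier G \<Longrightarrow> gp z x y = gp z y x"
  unfolding gp_def using d_sym[of x y] by simp

lemma gp_left [simp]:
  "a \<in> carrier G \<Longrightarrow> x \<in> carrier G \<Longrightarrow> y \<in> carrier G \<Longrightarrow> z \<in> carrier G \<Longrightarrow>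
   gp (a \<otimes> z) (a \<otimes> x) (a \<otimes> y) = gp z x y"
  unfolding gp_def by simp

lemma gp_nonneg: "x \<in> carrier G \<Longrightarrow> y \<in> carrier G \<Longrightarrow> z \<in> carrier G \<Longrightarrow> gp z x y \<ge> 0"
  unfolding gp_def using d_tri[of x z y] d_sym[of x z] by simp

lemma gp_le: "x \<in> carrier G \<Longrightarrow> y \<in> carrier G \<Longrightarrow> z \<in> carrier G \<Longrightarrow> gp z x y \<le> d z x"
  unfolding gp_def using d_tri[of z x y] by simp

lemma gp_swap: "x \<in> carrier G \<Longrightarrow> z \<in> carrier G \<Longrightarrow> gp z x y + gp x z y = d z x"
  unfolding gp_def using d_sym[of x z] by (simp add: field_simps)

lemma gp_self [simp]: "x \<in> carrier G \<Longrightarrow> gp x x y = 0" "x \<in> carrier G \<Longrightarrow> y \<in> carrier G \<Longrightarrow> gp x y x = 0"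
  unfolding gp_def using d_sym[of y x] by simp_all

lemma gp_move:
  assumes "x \<in> carrier G" "y \<in> carrier G" "z \<in> carrier G" "x' \<in> carrier G"
  shows "gp z x y \<le> gp z x' y + d x x'"
  unfolding gp_def using d_tri[of z x' x] d_tri[of x' x y] d_sym[of x x'] assms by (simp add: field_simps)

lemma d_inv: "x \<in> carrier G \<Longrightarrow> d \<one> (inv x) = d \<one> x"
  using d_left[of x \<one> "inv x"] d_sym[of x \<one>] by simp

lemma d_one_mult: "x \<in> carrier G \<Longrightarrow> y \<in> carrier G \<Longrightarrow> d \<one> (x \<otimes> y) \<le> d \<one> x + d \<one> y"
  using d_tri[of \<one> x "x \<otimes> y"] d_left[of x \<one> y] by simp

text \<open>Take \<open>p\<close> on a geodesic from \<open>x\<close> to \<open>y\<close> at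
  distance \<open>gp x z y\<close> from \<open>x\<close>, rounded down, which costs the summand 1.
  From \<open>x\<close>, both \<open>z\<close> and \<open>p\<close> point towards \<open>y\<close>
  for that long, so hyperbolicity at \<open>x\<close> bounds \<open>d z p\<close>.\<close>

lemma near_geodesic:
  assumes [simp]: "x \<in> carrier G" "y \<in> carrier G" "z \<in> carrier G" and c: "gp z x y \<le> c"
  shows "\<exists>p\<in>carrier G. d x p + d p y = d x y \<and> d z p \<le> c + 2 * \<delta> + 1"
proof -
  define T where "T = gp x z y"
  have T0: "T \<ge> 0" unfolding T_def by (simp add: gp_nonneg)
  have T1: "T \<le> d x y" unfolding T_def using gp_le[of y z x] gp_sym[of y z x] by simp
  define n where "n = nat \<lfloor>T\<rfloor>"
  have n: "real n \<le> T" "T \<le> real n + 1" unfolding n_def using T0 by linarith+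
  obtain p where p [simp]: "p \<in> carrier G" and pp: "d x p = real n" "d p y = d x y - real n"
    using geod[of x y n] n T1 by auto
  have "gp x y p = real n" unfolding gp_def using pp d_sym[of p y] by simp
  then have "gp x z p \<ge> real n - \<delta>" using gp_hyp[of x z p y] n T_def by auto
  then have "d z p \<le> d x z - real n + 2 * \<delta>" unfolding gp_def using pp by (simp add: field_simps)
  moreover have "d x z - T \<le> c" using gp_swap[of x z y] c d_sym[of x z] unfolding T_def by simp
  ultimately have "d z p \<le> c + 2 * \<delta> + 1" using n by simp
  then show ?thesis using pp by (intro bexI[OF _ p]) simp
qed

text \<open>A long side from \<open>q\<close> to \<open>r\<close> with a small turn at
  \<open>r\<close> makes \<open>gp q r s\<close> larger than \<open>C + \<delta>\<close>. If
  \<open>gp q p s\<close> were also that large, hyperbolicity at \<open>q\<close> would make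
  \<open>gp q p r\<close> exceed \<open>C\<close>.\<close>

lemma gp_concat:
  assumes "p \<in> carrier G" "q \<in> carrier G" "r \<in> carrier G" "s \<in> carrier G"
    and "gp q p r \<le> C" "gp r q s \<le> C'" "d q r > C + C' + \<delta>"
  shows "gp q p s \<le> C + \<delta>"
proof -
  have "gp q r s = d q r - gp r q s" using gp_swap[of r q s] assms by simp
  then have "gp q s r > C + \<delta>" using assms gp_sym[of r s q] by simp
  then show ?thesis using gp_hyp[of q p r s] assms by auto
qed

section \<open>Broken lines with long sides and small turns\<close>

lemma local_to_global_aux:
  fixes p :: "int \<Rightarrow> 'a"
  assumes "\<And>i. p i \<in> carrier G" "\<And>i. gp (p i) (p (i - 1)) (p (i + 1)) \<le> C"
    and "\<And>i. d (p i) (p (i + 1)) > 2 * C + 3 * \<delta>"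
  shows "gp (p j) (p (j + 1)) (p (j - 1 - int n)) \<le> C + \<delta>"
proof (induction n arbitrary: j)
  case 0
  then show ?case using assms(2)[of j] gp_sym[of "p (j - 1)" "p (j + 1)" "p j"] assms(1) delta_nonneg by simp
next
  case (Suc n)
  have 1: "gp (p j) (p (j + 1)) (p (j - 1)) \<le> C"
    using assms(2)[of j] gp_sym[of "p (j - 1)" "p (j + 1)" "p j"] assms(1) by simp
  have 2: "gp (p (j - 1)) (p j) (p (j - 2 - int n)) \<le> C + \<delta>"
    using Suc.IH[of "j - 1"] by simp
  have 3: "d (p j) (p (j - 1)) > 2 * C + 3 * \<delta>"
    using assms(3)[of "j - 1"] d_sym[of "p j" "p (j - 1)"] assms(1) by simp
  \<comment> \<open>The induction hypothesis bounds the turn at \<open>p (j - 1)\<close> by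
    \<open>C + \<delta>\<close>, and \<open>gp_concat\<close> returns the same bound at
    \<open>p j\<close>; the errors do not accumulate.\<close>
  have "gp (p j) (p (j + 1)) (p (j - 2 - int n)) \<le> C + \<delta>"
    by (rule gp_concat[OF assms(1) assms(1) assms(1) assms(1) 1 2]) (use 3 delta_nonneg in simp)
  then show ?case by (simp add: algebra_simps)
qed

text \<open>Two one-sided estimates with bound \<open>C + \<delta>\<close> are joined along the side
  from \<open>p j\<close> to \<open>p (j + 1)\<close>. This last use of \<open>gp_concat\<close>
  needs a side longer than \<open>2 * (C + \<delta>) + \<delta>\<close>, which is the length
  assumed.\<close>

lemma local_to_global:
  fixes p :: "int \<Rightarrow> 'a"
  assumes p: "\<And>i. p i \<in> carrier G" and b: "\<And>i. gp (p i) (p (i - 1)) (p (i + 1)) \<le> C"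
    and l: "\<And>i. d (p i) (p (i + 1)) > 2 * C + 3 * \<delta>" and ij: "i \<le> j" "j \<le> k"
  shows "gp (p j) (p i) (p k) \<le> C + 2 * \<delta>"
proof -
  have C0: "C \<ge> 0" using b[of 0] gp_nonneg[OF p p p, of 0 "-1" 1] by simp
  consider "i = j" | "j = k" | "i < j" "j < k" using ij by linarith
  then show ?thesis
  proof cases
    case 1
    then show ?thesis using C0 delta_nonneg p by simp
  next
    case 2
    then show ?thesis using C0 delta_nonneg p by simp
  next
    case 3
    have 1: "gp (p j) (p i) (p (j + 1)) \<le> C + \<delta>"
      using local_to_global_aux[of p C j "nat (j - 1 - i)", OF p b l] 3 gp_sym[OF p p] by simp
    \<comment> \<open>The estimate in the forward direction is the backward one for the reversed
      line.\<close>
    define q where "q i = p (- i)" for i :: int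
    have "gp (q (- j - 1)) (q (- j - 1 + 1)) (q (- j - 1 - 1 - int n)) \<le> C + \<delta>" for n
    proof (rule local_to_global_aux)
      show "gp (q i) (q (i - 1)) (q (i + 1)) \<le> C" for i
      proof -
        have "- (i - 1) = - i + 1" "- (i + 1) = - i - 1" by simp_all
        then show ?thesis
          using b[of "- i"] gp_sym[OF p p, of "p (- i)" "- i - 1" "- i + 1"] unfolding q_def
          by (simp only:)
      qed
      show "d (q i) (q (i + 1)) > 2 * C + 3 * \<delta>" for i
      proof -
        have "- (i + 1) = - i - 1" "- i - 1 + 1 = - i" by simp_all
        then show ?thesis
          using l[of "- i - 1"] d_sym[OF p p, of "- i" "- i - 1"] unfolding q_def by (simp only:)
      qed
    qed (simp add: q_def p)
    then have rev: "gp (p (j + 1)) (p j) (p (j + 2 + int n)) \<le> C + \<delta>" for n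
      unfolding q_def by (simp add: algebra_simps)
    show ?thesis
    proof (cases "k = j + 1")
      case True
      then show ?thesis using 1 delta_nonneg by simp
    next
      case False
      then have 2: "gp (p (j + 1)) (p j) (p k) \<le> C + \<delta>"
        using rev[of "nat (k - j - 2)"] 3 by simp
      have "gp (p j) (p i) (p k) \<le> C + \<delta> + \<delta>"
        by (rule gp_concat[OF p p p p 1 2]) (use l[of j] in simp)
      then show ?thesis by simp
    qed
  qed
qed

text \<open>A one-step criterion for loxodromic elements. The length exceeds what
  \<open>local_to_global\<close> asks for, and exceeds twice the global turn
  \<open>C + 2 * \<delta>\<close> by 1, so each further power moves at least 1 away from the unit.
  \<open>C\<close> is kept explicit because it must later be uniform over a family of
  elements.\<close>

definition lox :: "'a \<Rightarrow> real \<Rightarrow> bool" where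
  "lox g C \<longleftrightarrow> g \<in> carrier G \<and> gp \<one> (inv g) g \<le> C \<and> d \<one> g \<ge> 2 * C + 4 * \<delta> + 1"

lemma lox_carrier: "lox g C \<Longrightarrow> g \<in> carrier G"
  unfolding lox_def by simp

lemma lox_nonneg: "lox g C \<Longrightarrow> C \<ge> 0"
  unfolding lox_def using gp_nonneg[of "inv g" g \<one>] by simp

lemma lox_inv: "lox g C \<Longrightarrow> lox (inv g) C"
  unfolding lox_def using gp_sym[of "inv g" g \<one>] by (simp add: d_inv)

lemma lox_powers:
  assumes g: "lox g C" and ij: "i \<le> j" "j \<le> (k::int)"
  shows "gp (g [^] j) (g [^] i) (g [^] k) \<le> C + 2 * \<delta>"
proof (rule local_to_global[where p = "\<lambda>i. g [^] i"])
  have gc [simp]: "g \<in> carrier G" using g lox_carrier by simp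
  show "g [^] i \<in> carrier G" for i :: int by simp
  show "gp (g [^] i) (g [^] (i - 1)) (g [^] (i + 1)) \<le> C" for i :: int
    using gp_left[of "g [^] i" "inv g" g \<one>] g int_pow_mult[OF gc, of i "-1"] int_pow_mult[OF gc, of i 1]
    unfolding lox_def by (simp add: int_pow_neg)
  show "d (g [^] i) (g [^] (i + 1)) > 2 * C + 3 * \<delta>" for i :: int
    using d_left[of "g [^] i" \<one> g] g int_pow_mult[OF gc, of i 1] delta_nonneg
    unfolding lox_def by simp
qed (use ij in auto)

lemma lox_growth:
  assumes g: "lox g C"
  shows "d \<one> (g [^] i) \<ge> \<bar>real_of_int i\<bar>"
proof -
  have gc [simp]: "g \<in> carrier G" using g lox_carrier by simp
  have *: "d \<one> (g [^] (int n)) \<ge> real n" for n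
  proof (induction n)
    case (Suc n)
    have "gp (g [^] (int n)) (g [^] (0::int)) (g [^] (int (Suc n))) \<le> C + 2 * \<delta>"
      by (rule lox_powers[OF g]) auto
    moreover have "d (g [^] (int n)) (g [^] (int (Suc n))) = d \<one> g"
      using d_left[of "g [^] (int n)" \<one> g] int_pow_mult[OF gc, of "int n" 1] by (simp add: add.commute)
    ultimately show ?case using Suc.IH g d_sym[of \<one> "g [^] int n"]
      unfolding lox_def gp_def by (simp del: of_nat_Suc add: field_simps) 
  qed simp
  show ?thesis
  proof (cases "i \<ge> 0")
    case True
    then show ?thesis using *[of "nat i"] by simp
  next
    case False
    then show ?thesis using *[of "nat (- i)"] d_inv[of "g [^] i"] by (simp add: int_pow_neg)
  qed
qed

section \<open>Infinite subgroups contain loxodromic elements\<close>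

lemma four_point:
  assumes "x \<in> carrier G" "y \<in> carrier G" "z \<in> carrier G" "w \<in> carrier G"
  shows "d x y + d z w \<le> d x z + d y w + 2 * \<delta> \<or> d x y + d z w \<le> d x w + d y z + 2 * \<delta>"
  using gp_hyp[of w x y z] assms d_sym[of x w] d_sym[of y w] d_sym[of z w] d_sym[of y z]
  unfolding gp_def by (simp add: field_simps) linarith

lemma unbounded_subgroup:
  assumes "infinite H" "H \<subseteq> carrier G"
  shows "\<exists>h\<in>H. d \<one> h > r"
proof (rule ccontr)
  assume "\<not> ?thesis"
  then have "H \<subseteq> {x \<in> carrier G. d \<one> x \<le> r}" using assms by force
  then show False using assms finite_ball finite_subset by blast
qed

text \<open>In a subgroup without \<open>lox\<close> elements, all elements of \<open>H\<close> coarsely point in the same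
  direction and have zero translation length along it, so that a far away point is moved a
  uniformly bounded amount by all short elements. Local finiteness then bounds the number
  of elements of \<open>H\<close>.\<close>

lemma no_lox_gp:
  assumes H: "subgroup H G" and no: "\<And>g C. g \<in> H \<Longrightarrow> \<not> lox g C"
    and g: "g \<in> H" and h: "h \<in> H" and L: "L \<le> d \<one> g" "L \<le> d \<one> h"
  shows "gp \<one> g h \<ge> L / 2 - (6 * \<delta> + 1)"
proof (rule ccontr)
  assume "\<not> ?thesis"
  then have s: "gp \<one> g h < L / 2 - (6 * \<delta> + 1)" by simp
  have car [simp]: "g \<in> carrier G" "h \<in> carrier G" using g h subgroup.mem_carrier[OF H] by auto
  \<comment> \<open>The failure of \<open>lox\<close> with \<open>C\<close> equal to the turn
    itself: an element of \<open>H\<close> and its inverse point in nearly the same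
    direction.\<close>
  have nl: "d \<one> x < 2 * gp \<one> (inv x) x + 4 * \<delta> + 1" if "x \<in> H" for x
    using no[OF that, of "gp \<one> (inv x) x"] subgroup.mem_carrier[OF H that] unfolding lox_def by simp
  define t where "t = gp \<one> g h"
  have a: "gp \<one> (inv g) h \<le> t + \<delta>"
    using gp_hyp[of \<one> g h "inv g"] nl[OF g] s L gp_sym[of g "inv g" \<one>] delta_nonneg
    unfolding t_def by auto
  have b: "gp \<one> (inv h) g \<le> t + \<delta>"
    using gp_hyp[of \<one> g h "inv h"] nl[OF h] s L gp_sym[of g "inv h" \<one>] delta_nonneg
    unfolding t_def by auto
  \<comment> \<open>If \<open>g\<close> and \<open>h\<close> diverge early, then so do their
    inverses. Extending the turn at the unit first by \<open>g \<otimes> h\<close> beyond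
    \<open>g\<close>, then by \<open>inv h \<otimes> inv g\<close> beyond \<open>inv h\<close>,
    shows that \<open>g \<otimes> h\<close> is long and hardly backtracks, contrary to
    \<open>nl\<close>.\<close>
  have a1: "gp g \<one> (g \<otimes> h) \<le> t + \<delta>"
    using gp_left[of g "inv g" h \<one>] a by simp
  have a2: "gp (inv h) \<one> (inv h \<otimes> inv g) \<le> t + \<delta>"
    using gp_left[of "inv h" "inv g" h \<one>] a gp_sym[of \<one> "inv h \<otimes> inv g" "inv h"] by simp
  have c1: "gp \<one> (inv h) (g \<otimes> h) \<le> (t + \<delta>) + \<delta>"
    by (rule gp_concat[OF _ _ _ _ b a1]) (use s L t_def delta_nonneg in auto)
  then have c1': "gp \<one> (g \<otimes> h) (inv h) \<le> (t + \<delta>) + \<delta>"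
    using gp_sym[of "g \<otimes> h" "inv h" \<one>] by simp
  have "gp \<one> (g \<otimes> h) (inv h \<otimes> inv g) \<le> ((t + \<delta>) + \<delta>) + \<delta>"
    by (rule gp_concat[OF _ _ _ _ c1' a2]) (use s L t_def delta_nonneg in \<open>auto simp: d_inv\<close>)
  then have c2: "gp \<one> (inv (g \<otimes> h)) (g \<otimes> h) \<le> t + 3 * \<delta>"
    using gp_sym[of "g \<otimes> h" "inv h \<otimes> inv g" \<one>] by (simp add: inv_mult_group)
  have "d \<one> (g \<otimes> h) = d \<one> g + d \<one> h - 2 * gp \<one> (inv g) h"
    using d_left[of g "inv g" h] unfolding gp_def by (simp add: d_inv field_simps)
  then show False
    using nl[of "g \<otimes> h"] subgroup.m_closed[OF H g h] c2 a s L delta_nonneg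
    unfolding t_def by (simp add: field_simps)
qed

text \<open>Let \<open>x\<close> lie on a geodesic from the unit to a very distant \<open>h\<close>
  in \<open>H\<close>. Since all of \<open>H\<close> points the same way, a short \<open>g\<close>
  changes the distances of \<open>x\<close> to the unit and to \<open>h\<close> only by a constant,
  and two points with nearly the same position along a geodesic are close. It is essential that the
  bound \<open>16 * \<delta> + 2\<close> does not depend on \<open>r\<close>.\<close>

lemma no_lox_displacement:
  assumes H: "subgroup H G" and no: "\<And>g C. g \<in> H \<Longrightarrow> \<not> lox g C"
    and inf: "infinite H" and r: "r \<ge> 0"
  shows "\<exists>x\<in>carrier G. \<forall>g\<in>H. d \<one> g \<le> r \<longrightarrow> d x (g \<otimes> x) \<le> 16 * \<delta> + 2"
proof -
  have Hc: "H \<subseteq> carrier G" using H subgroup.subset by blast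
  define K where "K = 6 * \<delta> + 1"
  define T where "T = nat \<lceil>r + K\<rceil>"
  have T: "real T \<ge> r + K" unfolding T_def by linarith
  obtain h where h: "h \<in> H" and hl: "d \<one> h > 2 * real T + 2 * r + 4 * K + 4 * \<delta>"
    using unbounded_subgroup[OF inf Hc] by blast
  have [simp]: "h \<in> carrier G" using h Hc by blast
  have K0: "K \<ge> 0" unfolding K_def using delta_nonneg by simp
  obtain x where x [simp]: "x \<in> carrier G" and x1: "d \<one> x = real T" and x2: "d x h = d \<one> h - real T"
    using geod[of \<one> h T] hl r K0 delta_nonneg by auto
  have "d x (g \<otimes> x) \<le> 16 * \<delta> + 2" if g: "g \<in> H" and gr: "d \<one> g \<le> r" for g
  proof -
    have [simp]: "g \<in> carrier G" using g Hc by blast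
    have gi: "inv g \<in> H" using H g by (simp add: subgroup.m_inv_closed)
    have gh: "g \<otimes> h \<in> H" using H g h by (simp add: subgroup.m_closed)
    have lb: "d \<one> (g \<otimes> h) \<ge> d \<one> h - r"
      using d_one_mult[of "inv g" "g \<otimes> h"] gr by (simp add: d_inv)
    have p1: "gp \<one> (inv g) h \<ge> d \<one> g / 2 - K"
      unfolding K_def by (rule no_lox_gp[OF H no gi h]) (use gr hl r K0 delta_nonneg in \<open>auto simp: d_inv\<close>)
    have p2: "gp \<one> g (g \<otimes> h) \<ge> d \<one> g / 2 - K"
      unfolding K_def by (rule no_lox_gp[OF H no g gh]) (use gr hl lb r K0 delta_nonneg in \<open>auto simp: d_inv\<close>)
    have p3: "gp \<one> h (g \<otimes> h) \<ge> (d \<one> h - r) / 2 - K"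
      unfolding K_def by (rule no_lox_gp[OF H no h gh]) (use r lb in auto)
    have dgh: "d (inv g) h = d \<one> (g \<otimes> h)" using d_left[of g "inv g" h] by simp
    have dg: "d g (g \<otimes> h) = d \<one> h" using d_left[of g \<one> h] by simp
    \<comment> \<open>The term \<open>d \<one> g\<close> cancels here, so the lengths of
      \<open>h\<close> and \<open>g \<otimes> h\<close> differ by at most \<open>2 * K\<close>,
      however large \<open>r\<close> is.\<close>
    have q1: "d \<one> (g \<otimes> h) \<le> d \<one> h + 2 * K"
      using p1 dgh unfolding gp_def by (simp add: d_inv field_simps)
    have q2: "d \<one> h \<le> d \<one> (g \<otimes> h) + 2 * K"
      using p2 dg unfolding gp_def by (simp add: d_inv field_simps)
    have q3: "d h (g \<otimes> h) \<le> d \<one> (g \<otimes> h) + r + 2 * K"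
      using p3 unfolding gp_def by (simp add: field_simps)
    have gx1: "d g (g \<otimes> x) = real T" using d_left[of g \<one> x] x1 by simp
    have gx2: "d (g \<otimes> x) (g \<otimes> h) = d \<one> h - real T" using x2 by simp
    have e1: "d \<one> (g \<otimes> x) \<le> real T + 2 * K + 2 * \<delta>"
      using four_point[of "g \<otimes> x" \<one> g "g \<otimes> h"] gx1 gx2 dg q1 gr T K0 delta_nonneg
        d_sym[of "g \<otimes> x" \<one>] d_sym[of "g \<otimes> x" g] by simp linarith
    have e2: "d (g \<otimes> x) h \<le> d \<one> h - real T + 2 * K + 2 * \<delta>"
      using four_point[of "g \<otimes> x" h \<one> "g \<otimes> h"] e1 q2 q3 gx2 hl r K0 delta_nonneg
        d_sym[of "g \<otimes> x" \<one>] d_sym[of h \<one>] by simp linarith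
    have "d x (g \<otimes> x) \<le> 2 * K + 4 * \<delta>"
      using four_point[of x "g \<otimes> x" \<one> h] e1 e2 x1 x2 K0 delta_nonneg
        d_sym[of "g \<otimes> x" \<one>] d_sym[of x \<one>] by simp linarith
    then show ?thesis unfolding K_def by simp
  qed
  then show ?thesis using x by blast
qed

lemma infinite_subgroup_lox:
  assumes H: "subgroup H G" and inf: "infinite H"
  shows "\<exists>g\<in>H. \<exists>C. lox g C"
proof (rule ccontr)
  assume "\<not> ?thesis"
  then have no: "\<And>g C. g \<in> H \<Longrightarrow> \<not> lox g C" by blast
  have Hc: "H \<subseteq> carrier G" using H subgroup.subset by blast
  define Bl where "Bl = {x \<in> carrier G. d \<one> x \<le> 16 * \<delta> + 2}"
  have Bf: "finite Bl" unfolding Bl_def by (rule finite_ball)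
  obtain X where X: "X \<subseteq> H" "finite X" "card X = Suc (card Bl)"
    using infinite_arbitrarily_large[OF inf] by blast
  define r where "r = (\<Sum>x\<in>X. d \<one> x)"
  have r: "d \<one> x \<le> r" if "x \<in> X" for x
    unfolding r_def using that X(2) by (intro member_le_sum) auto
  have "r \<ge> 0" unfolding r_def by (simp add: sum_nonneg)
  then obtain x where x: "x \<in> carrier G" "\<And>g. g \<in> H \<Longrightarrow> d \<one> g \<le> r \<Longrightarrow> d x (g \<otimes> x) \<le> 16 * \<delta> + 2"
    using no_lox_displacement[OF H no inf] by blast
  \<comment> \<open>Conjugation by \<open>x\<close> embeds \<open>X\<close> in a ball that was
    chosen before \<open>X\<close>, which has one element more than the ball.\<close>
  define f where "f g = inv x \<otimes> (g \<otimes> x)" for g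
  have "f ` X \<subseteq> Bl"
  proof
    fix y assume "y \<in> f ` X"
    then obtain g where g: "g \<in> X" "y = f g" by auto
    then have gH: "g \<in> H" "g \<in> carrier G" using X Hc by auto
    have "d \<one> (f g) = d x (g \<otimes> x)"
      using d_left[of "inv x" x "g \<otimes> x"] x gH unfolding f_def by simp
    then show "y \<in> Bl" using x(2)[OF gH(1) r[OF g(1)]] g x(1) gH unfolding Bl_def f_def by simp
  qed
  moreover have "inj_on f X"
  proof (rule inj_onI)
    fix g h assume "g \<in> X" "h \<in> X" and eq: "f g = f h"
    then have c: "g \<in> carrier G" "h \<in> carrier G" using X Hc by auto
    then have "x \<otimes> f g = x \<otimes> f h" using eq by simp
    then have "g \<otimes> x = h \<otimes> x" using c x unfolding f_def by simp
    then show "g = h" using c x by simp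
  qed
  ultimately have "card X \<le> card Bl" using Bf card_inj_on_le by blast
  then show False using X by simp
qed

subsection \<open>Cosets of quasiconvex subgroups\<close>

text \<open>Geodesics enter through the metric equation for their points instead of through vertex
  lists, which makes left translation immediate. The constant is a parameter so that all members can
  share it.\<close>

definition qc :: "real \<Rightarrow> 'a set \<Rightarrow> bool" where
  "qc \<eta> F \<longleftrightarrow> subgroup F G \<and>
     (\<forall>x\<in>F. \<forall>y\<in>F. \<forall>p\<in>carrier G. d x p + d p y = d x y \<longrightarrow> (\<exists>a\<in>F. d p a \<le> \<eta>))"

text \<open>Replacing \<open>x\<close> and \<open>y\<close> by nearby points of the coset changes
  the Gromov product by at most \<open>2 * r\<close>. Then \<open>z\<close> is near a geodesic with
  endpoints in \<open>u <# F\<close>, and translation by \<open>inv u\<close> reduces the claim to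
  quasiconvexity of \<open>F\<close>.\<close>

lemma coset_convex:
  assumes F: "qc \<eta> F" and c [simp]: "u \<in> carrier G" "x \<in> carrier G" "y \<in> carrier G" "z \<in> carrier G"
    and f: "f \<in> F" "f' \<in> F" and n: "d x (u \<otimes> f) \<le> r" "d y (u \<otimes> f') \<le> r"
    and gp: "gp z x y \<le> c"
  shows "\<exists>a\<in>F. d z (u \<otimes> a) \<le> c + 2 * r + 2 * \<delta> + 1 + \<eta>"
proof -
  have sF: "subgroup F G" using F unfolding qc_def by simp
  have [simp]: "f \<in> carrier G" "f' \<in> carrier G" using f subgroup.mem_carrier[OF sF] by auto
  have "gp z (u \<otimes> f) (u \<otimes> f') \<le> gp z x y + 2 * r"
    using gp_move[of "u \<otimes> f" "u \<otimes> f'" z x] gp_move[of "u \<otimes> f'" x z y] n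
      gp_sym[of "u \<otimes> f'" x z] gp_sym[of y x z] d_sym[of "u \<otimes> f" x] d_sym[of "u \<otimes> f'" y] by simp
  then have "gp z (u \<otimes> f) (u \<otimes> f') \<le> c + 2 * r" using gp by simp
  then obtain p where p [simp]: "p \<in> carrier G"
    and p1: "d (u \<otimes> f) p + d p (u \<otimes> f') = d (u \<otimes> f) (u \<otimes> f')"
    and p2: "d z p \<le> c + 2 * r + 2 * \<delta> + 1"
    using near_geodesic[of "u \<otimes> f" "u \<otimes> f'" z] by auto
  have "d f (inv u \<otimes> p) + d (inv u \<otimes> p) f' = d f f'"
    using p1 d_left[of u f "inv u \<otimes> p"] d_left[of u "inv u \<otimes> p" f'] by simp
  then obtain a where a: "a \<in> F" "d (inv u \<otimes> p) a \<le> \<eta>"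
    using F f unfolding qc_def by (meson c(1) inv_closed m_closed p)
  have [simp]: "a \<in> carrier G" using a subgroup.mem_carrier[OF sF] by auto
  have "d p (u \<otimes> a) \<le> \<eta>" using d_left[of u "inv u \<otimes> p" a] a by simp
  then show ?thesis using p2 d_tri[of z p "u \<otimes> a"] a(1) by (intro bexI[of _ a]) auto
qed

section \<open>Products of boundedly many factors and the cosets along them\<close>

primrec prod_pow :: "'a set \<Rightarrow> nat \<Rightarrow> 'a set" where
  "prod_pow U 0 = {\<one>}"
| "prod_pow U (Suc n) = prod_pow U n <#> U"

lemma prod_pow_carrier: "U \<subseteq> carrier G \<Longrightarrow> prod_pow U n \<subseteq> carrier G"
  by (induction n) (auto simp: set_mult_def)

text \<open>The partial products of \<open>x\<close> are the vertices of a broken line. A side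
  starting at \<open>v\<close> either joins two points of the coset \<open>v <# F\<close> or has
  length at most \<open>D\<close>, and then it stays near \<open>v\<close>. Every side costs one
  application of hyperbolicity, hence \<open>real n * \<delta>\<close>. The set \<open>A\<close>
  must serve all \<open>c\<close> at once, because the induction passes from \<open>c\<close> to
  \<open>c + \<delta>\<close>.\<close>

lemma polygon_near_cosets:
  assumes Fs: "\<forall>F\<in>\<F>. qc \<eta> F" and ne: "\<F> \<noteq> {}" and D: "D \<ge> 0" "\<eta> \<ge> 0"
    and x: "x \<in> prod_pow (\<Union>\<F> \<union> {y \<in> carrier G. d \<one> y \<le> D}) n"
  shows "\<exists>A. finite A \<and> card A \<le> Suc n \<and> A \<subseteq> carrier G \<times> \<F> \<and>
     (\<forall>c. \<forall>z\<in>carrier G. gp z \<one> x \<le> c \<longrightarrow>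
        (\<exists>(u, F)\<in>A. \<exists>f\<in>F. d z (u \<otimes> f) \<le> c + real n * \<delta> + 2 * \<delta> + 1 + \<eta> + D))"
  using x
proof (induction n arbitrary: x)
  case 0
  \<comment> \<open>The degenerate line at the unit is charged to an arbitrary member; this accounts
    for \<open>Suc n\<close> cosets with only \<open>n\<close> factors.\<close>
  obtain F where F: "F \<in> \<F>" using ne by blast
  have "\<one> \<in> F" using bspec[OF Fs F] subgroup.one_closed unfolding qc_def by blast
  moreover have "d z \<one> \<le> c" if "gp z \<one> x \<le> c" "z \<in> carrier G" for z c
    using that 0 unfolding gp_def by simp
  ultimately show ?case using F D delta_nonneg
    by (intro exI[of _ "{(\<one>, F)}"]) (force intro!: bexI[of _ \<one>])
next
  case (Suc n)
  define U where "U = \<Union>\<F> \<union> {y \<in> carrier G. d \<one> y \<le> D}"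
  have Uc: "U \<subseteq> carrier G" unfolding U_def using Fs subgroup.subset unfolding qc_def by blast
  obtain v s where v: "v \<in> prod_pow U n" and s: "s \<in> U" and xv: "x = v \<otimes> s"
    using Suc.prems unfolding U_def[symmetric] by (auto simp: set_mult_def)
  have [simp]: "v \<in> carrier G" "s \<in> carrier G" using v s Uc prod_pow_carrier[OF Uc] by auto
  obtain A where A: "finite A" "card A \<le> Suc n" "A \<subseteq> carrier G \<times> \<F>"
    and AA: "\<forall>c. \<forall>z\<in>carrier G. gp z \<one> v \<le> c \<longrightarrow>
        (\<exists>(u, F)\<in>A. \<exists>f\<in>F. d z (u \<otimes> f) \<le> c + real n * \<delta> + 2 * \<delta> + 1 + \<eta> + D)"
    using Suc.IH[OF v[unfolded U_def]] by (elim exE conjE) (rule that; assumption)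
  obtain F where F: "F \<in> \<F>" and sF: "s \<in> F \<or> d \<one> s \<le> D" using s ne unfolding U_def by blast
  have qF: "qc \<eta> F" using Fs F by simp
  then have oF: "\<one> \<in> F" using subgroup.one_closed unfolding qc_def by blast
  have "\<exists>(u, F)\<in>insert (v, F) A. \<exists>f\<in>F. d z (u \<otimes> f) \<le> c + real (Suc n) * \<delta> + 2 * \<delta> + 1 + \<eta> + D"
    if z [simp]: "z \<in> carrier G" and c: "gp z \<one> x \<le> c" for c z
  proof -
    consider "gp z \<one> v \<le> c + \<delta>" | "gp z v x \<le> c + \<delta>" using gp_hyp[of z \<one> x v] c xv by auto
    then show ?thesis
    proof cases
      case 1
      then have "\<exists>(u, F)\<in>A. \<exists>f\<in>F. d z (u \<otimes> f) \<le> (c + \<delta>) + real n * \<delta> + 2 * \<delta> + 1 + \<eta> + D"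
        using AA[rule_format, OF z 1] by simp
      moreover have "(c + \<delta>) + real n * \<delta> = c + real (Suc n) * \<delta>" by (simp add: algebra_simps)
      ultimately show ?thesis by auto
    next
      case 2
      have "\<exists>f\<in>F. d z (v \<otimes> f) \<le> c + \<delta> + 2 * \<delta> + 1 + \<eta> + D"
      proof (cases "s \<in> F")
        case True
        have "\<exists>f\<in>F. d z (v \<otimes> f) \<le> c + \<delta> + 2 * 0 + 2 * \<delta> + 1 + \<eta>"
          by (rule coset_convex[OF qF _ _ _ _ oF True, of v v x z]) (use 2 xv in auto)
        then show ?thesis using D by force
      next
        case False
        then have "d \<one> s \<le> D" using sF by simp
        then have "d v x \<le> D" using d_left[of v \<one> s] xv by simp
        then have "d z (v \<otimes> \<one>) \<le> c + \<delta> + D"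
          using 2 d_tri[of z x v] d_sym[of x v] xv unfolding gp_def by (simp add: field_simps)
        then show ?thesis using oF D delta_nonneg by (intro bexI[of _ \<one>]) auto
      qed
      moreover have "\<delta> \<le> real (Suc n) * \<delta>" using delta_nonneg by (simp add: distrib_right)
      ultimately show ?thesis by force
    qed
  qed
  moreover have "finite (insert (v, F) A)" "card (insert (v, F) A) \<le> Suc (Suc n)"
    "insert (v, F) A \<subseteq> carrier G \<times> \<F>"
    using A F card_insert_le_m1[of "Suc (Suc n)" A] by (auto simp: card_insert_if)
  ultimately show ?case by (intro exI[of _ "insert (v, F) A"] conjI allI ballI impI) auto
qed

definition near_member :: "'a set set \<Rightarrow> real \<Rightarrow> 'a \<Rightarrow> bool" where
  "near_member \<F> B w \<longleftrightarrow> (\<exists>F\<in>\<F>. \<exists>e\<in>carrier G. \<exists>f\<in>F. d \<one> e \<le> B \<and> d w (e \<otimes> f) \<le> B)"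

lemma lox_power_escapes:
  assumes Fs: "\<forall>F\<in>\<F>. qc \<eta> F" and ne: "\<F> \<noteq> {}" and D: "D \<ge> 0" "\<eta> \<ge> 0"
    and w: "lox w C"
    and R: "R = (C + 2 * \<delta>) + real n * \<delta> + 2 * \<delta> + 1 + \<eta> + D"
    and B: "\<not> near_member \<F> ((C + 2 * \<delta>) + 2 * R + 2 * \<delta> + 1 + \<eta>) w"
  shows "w [^] (int (Suc n)) \<notin> prod_pow (\<Union>\<F> \<union> {y \<in> carrier G. d \<one> y \<le> D}) n"
proof
  assume x: "w [^] (int (Suc n)) \<in> prod_pow (\<Union>\<F> \<union> {y \<in> carrier G. d \<one> y \<le> D}) n"
  have wc [simp]: "w \<in> carrier G" using w lox_carrier by simp
  obtain A where A: "finite A" "card A \<le> Suc n" "A \<subseteq> carrier G \<times> \<F>"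
    and AA: "\<forall>c. \<forall>z\<in>carrier G. gp z \<one> (w [^] (int (Suc n))) \<le> c \<longrightarrow>
        (\<exists>(u, F)\<in>A. \<exists>f\<in>F. d z (u \<otimes> f) \<le> c + real n * \<delta> + 2 * \<delta> + 1 + \<eta> + D)"
    using polygon_near_cosets[OF Fs ne D x] by (elim exE conjE) (rule that; assumption)
  have "\<exists>a\<in>A. \<exists>f\<in>snd a. d (w [^] int i) (fst a \<otimes> f) \<le> R" if "i \<le> Suc n" for i
    using AA[rule_format, of "w [^] int i" "C + 2 * \<delta>"] lox_powers[OF w, of 0 "int i" "int (Suc n)"] that
    unfolding R by (auto simp: case_prod_beta)
  then obtain a where a: "\<And>i. i \<le> Suc n \<Longrightarrow> a i \<in> A"
    and af: "\<And>i. i \<le> Suc n \<Longrightarrow> \<exists>f\<in>snd (a i). d (w [^] int i) (fst (a i) \<otimes> f) \<le> R" by metis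
  \<comment> \<open>Pigeonhole: the exponents from 0 to \<open>Suc n\<close> are
    \<open>n + 2\<close> points, against at most \<open>n + 1\<close> cosets.\<close>
  have "\<not> inj_on a {..Suc n}"
  proof
    assume "inj_on a {..Suc n}"
    then have "card {..Suc n} \<le> card A" using a A(1) by (intro card_inj_on_le) auto
    then show False using A(2) by simp
  qed
  then obtain i j where ij: "i < j" "j \<le> Suc n" "a i = a j"
    unfolding inj_on_def by (metis atMost_iff linorder_neqE_nat)
  obtain u F where uF: "a i = (u, F)" "a j = (u, F)" using ij(3) by (metis surj_pair)
  then have u [simp]: "u \<in> carrier G" and F: "F \<in> \<F>" using a[of i] A(3) ij by auto
  have sF: "subgroup F G" using bspec[OF Fs F] unfolding qc_def by simp
  obtain f where f: "f \<in> F" "d (w [^] int i) (u \<otimes> f) \<le> R" using af[of i] ij uF by auto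
  obtain f' where f': "f' \<in> F" "d (w [^] int j) (u \<otimes> f') \<le> R" using af[of j] ij uF by auto
  define R' where "R' = (C + 2 * \<delta>) + 2 * R + 2 * \<delta> + 1 + \<eta>"
  have R0: "R \<ge> 0" "R \<le> R'" using f d_nonneg[of "w [^] int i" "u \<otimes> f"] lox_nonneg[OF w] delta_nonneg D
    unfolding R'_def by linarith+
  \<comment> \<open>The next power after \<open>w [^] int i\<close> lies coarsely between the two
    powers near the coset, so it is near that coset too.\<close>
  have "gp (w [^] int (Suc i)) (w [^] int i) (w [^] int j) \<le> C + 2 * \<delta>"
    by (rule lox_powers[OF w]) (use ij in auto)
  then obtain b where b: "b \<in> F" "d (w [^] int (Suc i)) (u \<otimes> b) \<le> R'"
    unfolding R'_def
    by (rule bexE[OF coset_convex[OF bspec[OF Fs F] u _ _ _ f(1) f'(1) f(2) f'(2)], rotated 3]) auto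
  have [simp]: "b \<in> carrier G" "f \<in> carrier G" using b f subgroup.mem_carrier[OF sF] by auto
  define v where "v = w [^] int i"
  have [simp]: "v \<in> carrier G" unfolding v_def by simp
  have vs: "w [^] int (Suc i) = v \<otimes> w"
    using int_pow_mult[OF wc, of "int i" 1] unfolding v_def by (simp add: add.commute)
  \<comment> \<open>Translating by the inverse of \<open>v\<close> moves the two consecutive powers
    to \<open>\<one>\<close> and \<open>w\<close>. Choosing the representative
    \<open>u \<otimes> f\<close> of the coset makes \<open>e\<close> short.\<close>
  define e where "e = inv v \<otimes> (u \<otimes> f)"
  have [simp]: "e \<in> carrier G" unfolding e_def by simp
  have "d \<one> e \<le> R'" using d_left[of "inv v" v "u \<otimes> f"] f(2) R0 unfolding e_def v_def[symmetric] by simp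
  moreover have "d w (e \<otimes> (inv f \<otimes> b)) \<le> R'"
    using d_left[of "inv v" "v \<otimes> w" "u \<otimes> b"] b(2) unfolding e_def vs by (simp add: m_assoc)
  moreover have "inv f \<otimes> b \<in> F" using sF b f by (simp add: subgroup.m_closed subgroup.m_inv_closed)
  ultimately have "near_member \<F> R' w" unfolding near_member_def using F by (meson \<open>e \<in> carrier G\<close>)
  then show False using B unfolding R'_def by simp
qed

subsection \<open>Commensurating elements\<close>

lemma lox_between:
  assumes g: "lox g C" and k: "0 \<le> k \<and> k \<le> n \<or> n \<le> k \<and> k \<le> (0::int)"
  shows "gp (g [^] k) \<one> (g [^] n) \<le> C + 2 * \<delta>"
  using k
proof
  assume "0 \<le> k \<and> k \<le> n"
  then show ?thesis using lox_powers[OF g, of 0 k n] by simp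
next
  assume "n \<le> k \<and> k \<le> 0"
  then show ?thesis
    using lox_powers[OF g, of n k 0] gp_sym[of "g [^] n" \<one> "g [^] k"] lox_carrier[OF g] by simp
qed

text \<open>Opposite powers of \<open>g\<close> point in different directions, so \<open>x\<close>
  cannot follow both of them for long. This allows the choice of a sign that avoids
  backtracking.\<close>

lemma lox_sign:
  assumes g: "lox g C" and x: "x \<in> carrier G" and n: "0 \<le> (n::int)"
  shows "gp \<one> x (g [^] n) \<le> C + 3 * \<delta> \<or> gp \<one> x (g [^] (- n)) \<le> C + 3 * \<delta>"
proof -
  have gc [simp]: "g \<in> carrier G" using g lox_carrier by simp
  have "gp \<one> (g [^] (- n)) (g [^] n) \<le> C + 2 * \<delta>"
    using lox_powers[OF g, of "- n" 0 n] n by simp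
  then show ?thesis
    using gp_hyp[of \<one> "g [^] (- n)" "g [^] n" x] gp_sym[of x "g [^] (- n)" \<one>] x by auto
qed

lemma d_int_pow_le:
  assumes g: "g \<in> carrier G"
  shows "d \<one> (g [^] (i::int)) \<le> real_of_int \<bar>i\<bar> * d \<one> g"
proof -
  have *: "d \<one> (g [^] int n) \<le> real n * d \<one> g" for n
  proof (induction n)
    case (Suc n)
    have "g [^] int (Suc n) = g [^] int n \<otimes> g"
      using int_pow_mult[OF g, of "int n" 1] g by (simp add: add.commute)
    then show ?case using Suc.IH d_one_mult[of "g [^] int n" g] g by (simp add: distrib_right)
  qed (use g in simp)
  show ?thesis
  proof (cases "i \<ge> 0")
    case True
    then show ?thesis using *[of "nat i"] by simp
  next
    case False
    then show ?thesis using *[of "nat (- i)"] d_inv[of "g [^] i"] g by (simp add: int_pow_neg)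
  qed
qed

text \<open>The conjugate of a positive power of \<open>g\<close> by \<open>t\<close> is again a
  power of \<open>g\<close>. The equation avoids inverses so that it can be raised to powers
  directly, and the sign of \<open>q'\<close> is free because \<open>t\<close> may exchange the ends
  of \<open>g\<close>.\<close>

definition commens :: "'a \<Rightarrow> 'a \<Rightarrow> bool" where
  "commens g t \<longleftrightarrow> (\<exists>(q::int) (q'::int). q > 0 \<and> t \<otimes> g [^] q = g [^] q' \<otimes> t)"

text \<open>The elements \<open>inv (g [^] k') \<otimes> (t \<otimes> g [^] k)\<close> lie in a
  finite ball, so two different \<open>k\<close> give the same element; comparing them yields the
  intertwining relation.\<close>

lemma commens_if_infinitely_close:
  assumes g [simp]: "g \<in> carrier G" and t [simp]: "t \<in> carrier G"
    and inf: "infinite {k::int. \<exists>k'::int. d (t \<otimes> g [^] k) (g [^] k') \<le> R}"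
  shows "commens g t"
proof -
  define I where "I = {k::int. \<exists>k'::int. d (t \<otimes> g [^] k) (g [^] k') \<le> R}"
  have "\<forall>k\<in>I. \<exists>k'::int. d (t \<otimes> g [^] k) (g [^] k') \<le> R" unfolding I_def by simp
  from bchoice[OF this] obtain \<kappa> :: "int \<Rightarrow> int"
    where \<kappa>: "\<And>k. k \<in> I \<Longrightarrow> d (t \<otimes> g [^] k) (g [^] \<kappa> k) \<le> R" by auto
  define f where "f k = inv (g [^] \<kappa> k) \<otimes> (t \<otimes> g [^] k)" for k
  have "f ` I \<subseteq> {x \<in> carrier G. d \<one> x \<le> R}"
  proof
    fix y assume "y \<in> f ` I"
    then obtain k where k: "k \<in> I" "y = f k" by blast
    have "d \<one> (f k) = d (g [^] \<kappa> k) (t \<otimes> g [^] k)"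
      using d_left[of "inv (g [^] \<kappa> k)" "g [^] \<kappa> k" "t \<otimes> g [^] k"] unfolding f_def by simp
    then show "y \<in> {x \<in> carrier G. d \<one> x \<le> R}"
      using \<kappa>[OF k(1)] k(2) d_sym[of "t \<otimes> g [^] k" "g [^] \<kappa> k"] unfolding f_def by simp
  qed
  then have "finite (f ` I)" using finite_ball finite_subset by blast
  then have "\<not> inj_on f I" using inf finite_imageD unfolding I_def by blast
  then obtain i j where ij: "i < j" "f i = f j" unfolding inj_on_def by (metis linorder_neqE)
  have "t \<otimes> g [^] (j - i) = t \<otimes> g [^] j \<otimes> inv (g [^] i)"
    using int_pow_mult[OF g, of j "- i"] by (simp add: int_pow_neg m_assoc)
  also have "\<dots> = g [^] \<kappa> j \<otimes> f j \<otimes> inv (g [^] i)"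
    unfolding f_def by simp
  also have "\<dots> = g [^] \<kappa> j \<otimes> f i \<otimes> inv (g [^] i)" using ij by simp
  also have "\<dots> = g [^] (\<kappa> j - \<kappa> i) \<otimes> t"
    unfolding f_def using int_pow_mult[OF g, of "\<kappa> j" "- \<kappa> i"] by (simp add: int_pow_neg m_assoc)
  finally show ?thesis unfolding commens_def using ij(1)
    by (intro exI[of _ "j - i"] exI[of _ "\<kappa> j - \<kappa> i"]) simp
qed

text \<open>Walk along the powers of \<open>g\<close> until the distance from the unit first reaches
  that of \<open>x\<close>. The power reached has nearly the length of \<open>x\<close>, up to
  \<open>d \<one> g\<close>, and points in the same direction, so it is close to
  \<open>x\<close>.\<close>

lemma near_axis_nat:
  assumes g: "lox g C" and x [simp]: "x \<in> carrier G" and c: "c \<ge> 0"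
    and gp: "gp \<one> x (g [^] int n) \<ge> d \<one> x - c"
  shows "\<exists>j::int. d x (g [^] j) \<le> d \<one> g + 2 * c + 2 * C + 6 * \<delta>"
proof -
  have gc [simp]: "g \<in> carrier G" using g lox_carrier by simp
  have C0: "C \<ge> 0" using lox_nonneg[OF g] .
  show ?thesis
  proof (cases "d \<one> (g [^] int n) < d \<one> x")
    case True
    then have "d x (g [^] int n) \<le> 2 * c" using gp unfolding gp_def by simp
    then show ?thesis using C0 delta_nonneg d_nonneg[of \<one> g] by (intro exI[of _ "int n"]) linarith
  next
    case False
    define j where "j = (LEAST j. d \<one> (g [^] int j) \<ge> d \<one> x)"
    have j1: "d \<one> (g [^] int j) \<ge> d \<one> x" unfolding j_def by (rule LeastI[of _ n]) (use False in simp)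
    have j2: "j \<le> n" unfolding j_def by (rule Least_le) (use False in simp)
    have j3: "d \<one> (g [^] int j) \<le> d \<one> x + d \<one> g"
    proof (cases j)
      case (Suc i)
      then have "\<not> d \<one> (g [^] int i) \<ge> d \<one> x" unfolding j_def by (metis lessI not_less_Least)
      moreover have "g [^] int j = g [^] int i \<otimes> g"
        using int_pow_mult[OF gc, of "int i" 1] Suc by (simp add: add.commute)
      ultimately show ?thesis using d_one_mult[of "g [^] int i" g] by simp
    qed simp
    have "gp (g [^] int j) \<one> (g [^] int n) \<le> C + 2 * \<delta>"
      by (rule lox_between[OF g]) (use j2 in simp)
    then have "gp \<one> (g [^] int j) (g [^] int n) \<ge> d \<one> x - C - 2 * \<delta>"
      using gp_swap[of \<one> "g [^] int j" "g [^] int n"] j1 d_sym[of \<one> "g [^] int j"] by simp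
    then have "gp \<one> x (g [^] int j) \<ge> d \<one> x - c - C - 3 * \<delta>"
      using gp_hyp[of \<one> x "g [^] int j" "g [^] int n"] gp c C0 delta_nonneg
        gp_sym[of "g [^] int j" "g [^] int n" \<one>] by auto
    then have "d x (g [^] int j) \<le> d \<one> g + 2 * c + 2 * C + 6 * \<delta>"
      using j3 unfolding gp_def by (simp add: field_simps)
    then show ?thesis by blast
  qed
qed

lemma near_axis:
  assumes g: "lox g C" and x [simp]: "x \<in> carrier G" and c: "c \<ge> 0"
    and gp: "gp \<one> x (g [^] (i::int)) \<ge> d \<one> x - c"
  shows "\<exists>j::int. d x (g [^] j) \<le> d \<one> g + 2 * c + 2 * C + 6 * \<delta>"
proof (cases "i \<ge> 0")
  case True
  then show ?thesis using near_axis_nat[OF g x c, of "nat i"] gp by simp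
next
  case False
  have gc [simp]: "g \<in> carrier G" using g lox_carrier by simp
  have e: "inv g [^] k = g [^] (- k)" for k :: int by (simp add: int_pow_neg int_pow_inv)
  have "\<exists>j::int. d x (inv g [^] j) \<le> d \<one> (inv g) + 2 * c + 2 * C + 6 * \<delta>"
    by (rule near_axis_nat[OF lox_inv[OF g] x c, of "nat (- i)"]) (use gp False e in simp)
  then show ?thesis unfolding e d_inv[OF gc] by blast
qed

text \<open>If \<open>t \<langle>g\<rangle> t\<inverse>\<close> and \<open>\<langle>g\<rangle>\<close> had a common end, then
  \<open>t g\<^sup>k\<close> would stay close to \<open>\<langle>g\<rangle>\<close> for infinitely many \<open>k\<close>.\<close>

lemma not_commens_bounded:
  assumes g: "lox g C" and t [simp]: "t \<in> carrier G" and nc: "\<not> commens g t"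
  shows "\<exists>M. \<forall>(n::int) (m::int). gp \<one> (t \<otimes> g [^] n \<otimes> inv t) (g [^] m) \<le> M"
proof (rule ccontr)
  assume "\<not> ?thesis"
  then have unb: "\<exists>(n::int) (m::int). gp \<one> (t \<otimes> g [^] n \<otimes> inv t) (g [^] m) > c" for c by (metis not_le)
  have gc [simp]: "g \<in> carrier G" using g lox_carrier by simp
  define c where "c = C + 3 * \<delta> + d \<one> t"
  have c0: "c \<ge> 0" unfolding c_def using lox_nonneg[OF g] delta_nonneg by simp
  define I where "I = {k::int. \<exists>k'::int. d (t \<otimes> g [^] k) (g [^] k') \<le> d \<one> g + 2 * c + 2 * C + 6 * \<delta>}"
  \<comment> \<open>A large Gromov product forces the exponent \<open>n\<close> past
    \<open>N\<close>. For \<open>k\<close> of size \<open>N\<close> and the sign of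
    \<open>n\<close>, the point \<open>t \<otimes> g [^] k\<close> lies coarsely on the way to
    \<open>t \<otimes> g [^] n\<close>, hence along a power of \<open>g\<close>, and
    \<open>near_axis\<close> applies.\<close>
  have I: "\<exists>k\<in>I. \<bar>k\<bar> = int N" for N
  proof -
    obtain n m :: int where nm: "gp \<one> (t \<otimes> g [^] n \<otimes> inv t) (g [^] m) > 2 * d \<one> t + real N * d \<one> g"
      using unb by blast
    have "gp \<one> (t \<otimes> g [^] n \<otimes> inv t) (g [^] m) \<le> d \<one> (t \<otimes> g [^] n \<otimes> inv t)"
      by (rule gp_le) auto
    also have "\<dots> \<le> 2 * d \<one> t + real_of_int \<bar>n\<bar> * d \<one> g"
      using d_one_mult[of "t \<otimes> g [^] n" "inv t"] d_one_mult[of t "g [^] n"] d_int_pow_le[OF gc, of n]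
      by (simp add: d_inv)
    finally have "real N * d \<one> g < real_of_int \<bar>n\<bar> * d \<one> g" using nm by simp
    then have nN: "\<bar>n\<bar> > int N" by (smt (verit) d_nonneg mult_right_mono of_int_of_nat_eq of_int_le_iff)
    define k where "k = (if n \<ge> 0 then int N else - int N)"
    have k: "0 \<le> k \<and> k \<le> n \<or> n \<le> k \<and> k \<le> 0" "\<bar>k\<bar> = int N" using nN unfolding k_def by auto
    have "gp (t \<otimes> g [^] k) t (t \<otimes> g [^] n) \<le> C + 2 * \<delta>"
      using gp_left[of t \<one> "g [^] n" "g [^] k"] lox_between[OF g k(1)] by simp
    then have "gp (t \<otimes> g [^] k) \<one> (t \<otimes> g [^] n) \<le> C + 2 * \<delta> + d \<one> t"
      using gp_move[of \<one> "t \<otimes> g [^] n" "t \<otimes> g [^] k" t] by simp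
    then have 1: "gp \<one> (t \<otimes> g [^] k) (t \<otimes> g [^] n) \<ge> d \<one> (t \<otimes> g [^] k) - (C + 2 * \<delta> + d \<one> t)"
      using gp_swap[of \<one> "t \<otimes> g [^] k" "t \<otimes> g [^] n"] d_sym[of \<one> "t \<otimes> g [^] k"] by simp
    have "d (t \<otimes> g [^] n \<otimes> inv t) (t \<otimes> g [^] n) = d \<one> t"
      using d_left[of "t \<otimes> g [^] n \<otimes> inv t" \<one> t] d_sym[of "t \<otimes> g [^] n \<otimes> inv t" "t \<otimes> g [^] n"]
      by (simp add: m_assoc)
    then have "gp \<one> (t \<otimes> g [^] n) (g [^] m) \<ge> d \<one> t + real N * d \<one> g"
      using gp_move[of "t \<otimes> g [^] n \<otimes> inv t" "g [^] m" \<one> "t \<otimes> g [^] n"] nm by simp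
    moreover have "d \<one> (t \<otimes> g [^] k) \<le> d \<one> t + real N * d \<one> g"
      using d_one_mult[of t "g [^] k"] d_int_pow_le[OF gc, of k] k(2) by simp
    ultimately have "gp \<one> (t \<otimes> g [^] k) (g [^] m) \<ge> d \<one> (t \<otimes> g [^] k) - c"
      using gp_hyp[of \<one> "t \<otimes> g [^] k" "g [^] m" "t \<otimes> g [^] n"] 1 c0 lox_nonneg[OF g] delta_nonneg
        d_nonneg[of \<one> t]
      unfolding c_def by (auto, linarith)
    then have "k \<in> I" unfolding I_def using near_axis[OF g _ c0] by simp
    then show ?thesis using k(2) by blast
  qed
  have "infinite I"
  proof
    assume "finite I"
    then have "finite (abs ` I)" by simp
    moreover have "range int \<subseteq> abs ` I"
    proof (rule image_subsetI)
      show "int N \<in> abs ` I" for N using I[of N] by (metis image_eqI)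
    qed
    ultimately have "finite (range int)" using finite_subset by blast
    then show False using finite_imageD[of int UNIV] by simp
  qed
  then show False using commens_if_infinitely_close[OF gc t] nc unfolding I_def by blast
qed

text \<open>If a shortest element \<open>t\<close> of its coset followed the axis of
  \<open>g\<close> beyond a power \<open>g [^] k\<close>, then removing that power from the left
  would shorten \<open>t\<close>.\<close>

lemma minimal_gp_bounded:
  assumes g: "lox g C"
  shows "\<exists>M. \<forall>t\<in>carrier G. (\<forall>m::int. d \<one> t \<le> d \<one> (g [^] m \<otimes> t)) \<longrightarrow>
     (\<forall>n::int. gp \<one> t (g [^] n) \<le> M)"
proof -
  have gc [simp]: "g \<in> carrier G" using g lox_carrier by simp
  \<comment> \<open>With this size of \<open>k\<close>, half the length of \<open>g [^] k\<close> is
    smaller than \<open>d \<one> (g [^] k) - (C + 3 * \<delta>)\<close>, which rules out one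
    alternative of hyperbolicity.\<close>
  define N where "N = nat \<lceil>2 * (C + 3 * \<delta>)\<rceil> + 1"
  have N: "real N > 2 * (C + 3 * \<delta>)" unfolding N_def by linarith
  have "gp \<one> t (g [^] n) \<le> real N * d \<one> g + \<delta>"
    if t [simp]: "t \<in> carrier G" and m: "\<And>m::int. d \<one> t \<le> d \<one> (g [^] m \<otimes> t)" for t and n :: int
  proof (cases "\<bar>n\<bar> \<le> int N")
    case True
    have "gp \<one> t (g [^] n) \<le> d \<one> (g [^] n)"
      using gp_le[of "g [^] n" t \<one>] gp_sym[of t "g [^] n" \<one>] by simp
    also have "\<dots> \<le> real_of_int \<bar>n\<bar> * d \<one> g" by (rule d_int_pow_le[OF gc])
    also have "\<dots> \<le> real N * d \<one> g" using True by (intro mult_right_mono) (linarith, simp)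
    finally show ?thesis using delta_nonneg by simp
  next
    case False
    define k where "k = (if n \<ge> 0 then int N else - int N)"
    have k: "0 \<le> k \<and> k \<le> n \<or> n \<le> k \<and> k \<le> 0" "\<bar>k\<bar> = int N" using False unfolding k_def by auto
    have 1: "gp \<one> (g [^] k) (g [^] n) \<ge> d \<one> (g [^] k) - (C + 2 * \<delta>)"
      using lox_between[OF g k(1)] gp_swap[of \<one> "g [^] k" "g [^] n"] d_sym[of \<one> "g [^] k"] by simp
    have "d (g [^] k) t = d \<one> (g [^] (- k) \<otimes> t)"
      using d_left[of "g [^] (- k)" "g [^] k" t] by (simp add: int_pow_neg)
    then have 2: "gp \<one> t (g [^] k) \<le> d \<one> (g [^] k) / 2"
      using m[of "- k"] d_sym[of t "g [^] k"] unfolding gp_def by simp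
    have 3: "d \<one> (g [^] k) \<ge> real N" using lox_growth[OF g, of k] k(2) by simp
    have 4: "d \<one> (g [^] k) \<le> real N * d \<one> g" using d_int_pow_le[OF gc, of k] k(2) by simp
    have "gp \<one> t (g [^] n) \<le> d \<one> (g [^] k) / 2 + \<delta>"
      using gp_hyp[of \<one> t "g [^] k" "g [^] n"] gp_sym[of "g [^] k" "g [^] n" \<one>] 1 2 3 N by auto
    then show ?thesis using 4 d_nonneg[of \<one> "g [^] k"] by linarith
  qed
  then show ?thesis by blast
qed

lemma intertwine_int_pow:
  assumes c [simp]: "t \<in> carrier G" "a \<in> carrier G" "b \<in> carrier G" and e: "t \<otimes> a = b \<otimes> t"
  shows "t \<otimes> a [^] (k::int) = b [^] k \<otimes> t"
proof -
  have *: "t \<otimes> a [^] int n = b [^] int n \<otimes> t" for n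
  proof (induction n)
    case (Suc n)
    have s: "x [^] int (Suc n) = x [^] int n \<otimes> x" if "x \<in> carrier G" for x
      using int_pow_mult[OF that, of "int n" 1] that by (simp add: add.commute)
    have "t \<otimes> a [^] int (Suc n) = (t \<otimes> a [^] int n) \<otimes> a" by (simp only: s c) (simp add: m_assoc)
    also have "\<dots> = b [^] int n \<otimes> (t \<otimes> a)" by (simp only: Suc.IH) (simp add: m_assoc)
    also have "\<dots> = b [^] int (Suc n) \<otimes> t" unfolding e by (simp only: s c) (simp add: m_assoc)
    finally show ?case .
  qed simp
  show ?thesis
  proof (cases "k \<ge> 0")
    case True
    then show ?thesis using *[of "nat k"] by simp
  next
    case False
    define x where "x = a [^] int (nat (- k))"
    define y where "y = b [^] int (nat (- k))"
    have [simp]: "x \<in> carrier G" "y \<in> carrier G" unfolding x_def y_def by auto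
    have xy: "t \<otimes> x = y \<otimes> t" unfolding x_def y_def by (rule *)
    have "t \<otimes> inv x = inv y \<otimes> (y \<otimes> t) \<otimes> inv x" by simp
    also have "\<dots> = inv y \<otimes> t" unfolding xy[symmetric] by (simp add: m_assoc)
    finally show ?thesis using False unfolding x_def y_def by (simp add: int_pow_neg)
  qed
qed

text \<open>For a large multiple of suitable sign, the path from the unit through \<open>t\<close>
  to \<open>t \<otimes> g [^] (q * k)\<close> does not backtrack. Its endpoint is within
  \<open>d \<one> t\<close> of the power \<open>g [^] (q' * k)\<close>, so \<open>t\<close> points
  towards that power for almost its whole length, while \<open>M\<close> bounds how long it may do
  so.\<close>

lemma commens_minimal_short:
  assumes g: "lox g C" and t [simp]: "t \<in> carrier G" and ct: "commens g t"
    and M: "\<And>n::int. gp \<one> t (g [^] n) \<le> M"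
  shows "d \<one> t \<le> M + C + 4 * \<delta>"
proof -
  have gc [simp]: "g \<in> carrier G" using g lox_carrier by simp
  obtain q q' :: int where q: "q > 0" and qq: "t \<otimes> g [^] q = g [^] q' \<otimes> t"
    using ct unfolding commens_def by blast
  \<comment> \<open>The factor 4 leaves \<open>d \<one> x\<close> at least three times
    \<open>d \<one> t\<close>, enough for \<open>gp \<one> x y\<close> to reach
    \<open>d \<one> t\<close>.\<close>
  define N where "N = int (nat \<lceil>4 * d \<one> t\<rceil>)"
  have N: "real_of_int N \<ge> 4 * d \<one> t" "N \<ge> 0" unfolding N_def by linarith+
  have pw: "t \<otimes> g [^] (q * k) = g [^] (q' * k) \<otimes> t" for k :: int
    using intertwine_int_pow[OF t _ _ qq, of k] by (simp add: int_pow_pow)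
  have "gp \<one> (inv t) (g [^] (q * N)) \<le> C + 3 * \<delta> \<or> gp \<one> (inv t) (g [^] (q * (- N))) \<le> C + 3 * \<delta>"
    using lox_sign[OF g, of "inv t" "q * N"] q N by simp
  then obtain k where k: "\<bar>k\<bar> = N" and 1: "gp \<one> (inv t) (g [^] (q * k)) \<le> C + 3 * \<delta>"
    using N(2) by (metis abs_minus abs_of_nonneg)
  define x where "x = t \<otimes> g [^] (q * k)"
  define y where "y = g [^] (q' * k)"
  have [simp]: "x \<in> carrier G" "y \<in> carrier G" unfolding x_def y_def by auto
  have xy: "x = y \<otimes> t" unfolding x_def y_def by (rule pw)
  have "gp t \<one> x \<le> C + 3 * \<delta>" using gp_left[of t "inv t" "g [^] (q * k)" \<one>] 1 unfolding x_def by simp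
  then have 2: "gp \<one> t x \<ge> d \<one> t - (C + 3 * \<delta>)" using gp_swap[of \<one> t x] d_sym[of \<one> t] by simp
  have dxy: "d x y = d \<one> t" using d_left[of y t \<one>] xy d_sym[of t \<one>] by simp
  have "1 * N \<le> q * N" using q N(2) by (intro mult_right_mono) auto
  then have "\<bar>q * k\<bar> \<ge> N" using k q by (simp add: abs_mult)
  then have "d \<one> (g [^] (q * k)) \<ge> 4 * d \<one> t" using lox_growth[OF g, of "q * k"] N by linarith
  moreover have "d \<one> (g [^] (q * k)) \<le> d \<one> t + d \<one> x"
    using d_one_mult[of "inv t" x] unfolding x_def by (simp add: d_inv)
  ultimately have dx: "d \<one> x \<ge> 3 * d \<one> t" by simp
  have "gp \<one> x y \<ge> d \<one> t"
  proof -
    have "d \<one> x \<le> d \<one> y + d x y" using d_tri[of \<one> y x] d_sym[of y x] by simp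
    moreover have "0 \<le> d \<one> y" by (rule d_nonneg)
    ultimately have "2 * d \<one> t \<le> d \<one> x + d \<one> y - d x y" using dx dxy by argo
    then show ?thesis unfolding gp_def by simp
  qed
  then have "gp \<one> t y \<ge> d \<one> t - (C + 3 * \<delta>) - \<delta>"
    using gp_hyp[of \<one> t y x] 2 lox_nonneg[OF g] delta_nonneg by auto
  then show ?thesis using M[of "q' * k"] unfolding y_def by simp
qed

text \<open>A shortest element of the coset of \<open>v\<close> under left multiplication by powers
  of \<open>g\<close> lies in \<open>H\<close>, so it commensurates \<open>g\<close> and is short.
  As balls are finite, the powers of \<open>g\<close> have finite index in \<open>H\<close>.\<close>

lemma commens_subgroup_cobounded:
  assumes g: "lox g C" and H: "subgroup H G" and gH: "g \<in> H" and all: "\<And>t. t \<in> H \<Longrightarrow> commens g t"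
  shows "\<exists>L. \<forall>v\<in>H. \<exists>m::int. d \<one> (g [^] m \<otimes> v) \<le> L"
proof -
  have gc [simp]: "g \<in> carrier G" using g lox_carrier by simp
  obtain M where M: "\<forall>t\<in>carrier G. (\<forall>m::int. d \<one> t \<le> d \<one> (g [^] m \<otimes> t)) \<longrightarrow>
     (\<forall>n::int. gp \<one> t (g [^] n) \<le> M)" using minimal_gp_bounded[OF g]
    by (elim exE) (rule that; assumption)
  have "\<exists>m::int. d \<one> (g [^] m \<otimes> v) \<le> M + C + 4 * \<delta>" if v: "v \<in> H" for v
  proof -
    have [simp]: "v \<in> carrier G" by (rule subgroup.mem_carrier[OF H v])
    define f where "f m = nat \<lfloor>d \<one> (g [^] m \<otimes> v)\<rfloor>" for m :: int
    have f: "d \<one> (g [^] m \<otimes> v) = real (f m)" for m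
      using d_nat[of \<one> "g [^] m \<otimes> v"] unfolding f_def by auto
    obtain m where m: "\<And>m'. f m \<le> f m'" using ex_has_least_nat[of "\<lambda>_. True" undefined f] by blast
    define t where "t = g [^] m \<otimes> v"
    have [simp]: "t \<in> carrier G" unfolding t_def by simp
    have "g [^] m \<in> H" using H gH by (rule subgroup_int_pow_closed)
    then have tH: "t \<in> H" unfolding t_def by (rule subgroup.m_closed[OF H _ v])
    have "d \<one> t \<le> d \<one> (g [^] m' \<otimes> t)" for m' :: int
    proof -
      have "g [^] m' \<otimes> t = g [^] (m' + m) \<otimes> v" unfolding t_def by (simp add: int_pow_mult m_assoc)
      then show ?thesis using f m unfolding t_def by simp
    qed
    then have "d \<one> t \<le> M + C + 4 * \<delta>"
      using commens_minimal_short[OF g _ all[OF tH], of M] M by simp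
    then show ?thesis unfolding t_def by blast
  qed
  then show ?thesis by blast
qed

section \<open>Loxodromic elements far from the members\<close>

definition thin :: "'a set \<Rightarrow> 'a set set \<Rightarrow> bool" where
  "thin H \<F> \<longleftrightarrow> (\<forall>e\<in>carrier G. \<forall>F\<in>\<F>. \<forall>T. finite T \<longrightarrow> T \<subseteq> carrier G \<longrightarrow>
     \<not> H \<subseteq> (e <# F) <#> T)"

text \<open>If all high powers of \<open>g\<close> were near members, two of them would have the
  form \<open>a \<otimes> f \<otimes> b\<close> with the same member and the same \<open>a\<close>
  and \<open>b\<close>. Then a positive power of \<open>g\<close> lies in a conjugate of that
  member, and since \<open>g\<close> generates a subgroup of finite index in \<open>H\<close>,
  finitely many translates of one coset cover \<open>H\<close>.\<close>

lemma commens_power_escapes: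
  assumes g: "lox g C" and H: "subgroup H G" and gH: "g \<in> H" and all: "\<And>t. t \<in> H \<Longrightarrow> commens g t"
    and fin: "finite \<F>" and sub: "\<And>F. F \<in> \<F> \<Longrightarrow> subgroup F G" and thin: "thin H \<F>"
  shows "\<exists>n\<ge>N. \<not> near_member \<F> B (g [^] int n)"
proof (rule ccontr)
  assume "\<not> ?thesis"
  then have near: "near_member \<F> B (g [^] int n)" if "n \<ge> N" for n using that by blast
  have gc [simp]: "g \<in> carrier G" using g lox_carrier by simp
  define Bl where "Bl = {x \<in> carrier G. d \<one> x \<le> B}"
  have "\<exists>x. fst x \<in> \<F> \<and> fst (snd x) \<in> Bl \<and> snd (snd x) \<in> Bl \<and>
      (\<exists>f\<in>fst x. g [^] int n = fst (snd x) \<otimes> f \<otimes> snd (snd x))" if n: "n \<ge> N" for n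
  proof -
    obtain F e f where F: "F \<in> \<F>" and e: "e \<in> carrier G" and f: "f \<in> F"
      and de: "d \<one> e \<le> B" and df: "d (g [^] int n) (e \<otimes> f) \<le> B"
      using near[OF n] unfolding near_member_def by blast
    have [simp]: "f \<in> carrier G" "e \<in> carrier G" using subgroup.mem_carrier[OF sub[OF F] f] e by auto
    define b where "b = inv (e \<otimes> f) \<otimes> g [^] int n"
    have "d \<one> b = d (e \<otimes> f) (g [^] int n)"
      using d_left[of "inv (e \<otimes> f)" "e \<otimes> f" "g [^] int n"] unfolding b_def by simp
    then have "b \<in> Bl" using df d_sym[of "e \<otimes> f" "g [^] int n"] unfolding Bl_def b_def by simp
    moreover have "g [^] int n = e \<otimes> f \<otimes> b" unfolding b_def by simp
    moreover have "e \<in> Bl" using de unfolding Bl_def by simp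
    ultimately show ?thesis using F f by (intro exI[of _ "(F, e, b)"]) auto
  qed
  then have "\<forall>n\<in>{N..}. \<exists>x. fst x \<in> \<F> \<and> fst (snd x) \<in> Bl \<and> snd (snd x) \<in> Bl \<and>
      (\<exists>f\<in>fst x. g [^] int n = fst (snd x) \<otimes> f \<otimes> snd (snd x))"
    by simp
  from bchoice[OF this] obtain z where z: "\<And>n. n \<ge> N \<Longrightarrow> fst (z n) \<in> \<F> \<and> fst (snd (z n)) \<in> Bl \<and>
      snd (snd (z n)) \<in> Bl \<and> (\<exists>f\<in>fst (z n). g [^] int n = fst (snd (z n)) \<otimes> f \<otimes> snd (snd (z n)))"
    by auto
  have "z ` {N..} \<subseteq> \<F> \<times> Bl \<times> Bl" using z by (intro image_subsetI) (simp add: mem_Times_iff)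
  moreover have "finite Bl" unfolding Bl_def by (rule finite_ball)
  ultimately have "finite (z ` {N..})" using fin finite_subset by (metis finite_cartesian_product)
  then have "\<not> inj_on z {N..}" using finite_imageD infinite_Ici by blast
  then obtain x y where "N \<le> x" "N \<le> y" "z x = z y" "x \<noteq> y"
    unfolding inj_on_def by auto
  then obtain i j where ij: "N \<le> i" "i < j" "z i = z j" by (metis nat_neq_iff)
  obtain A a b where zi: "z i = (A, a, b)" by (metis surj_pair)
  have zA: "A \<in> \<F>" "a \<in> Bl" "b \<in> Bl" using z[OF ij(1)] zi by auto
  obtain f1 where f1: "f1 \<in> A" "g [^] int i = a \<otimes> f1 \<otimes> b" using z[OF ij(1)] zi by auto
  have "N \<le> j" using ij by simp
  then obtain f2 where f2: "f2 \<in> A" "g [^] int j = a \<otimes> f2 \<otimes> b" using z[of j] zi ij(3) by auto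
  have sA: "subgroup A G" using zA(1) by (rule sub)
  have [simp]: "f1 \<in> carrier G" "f2 \<in> carrier G" using f1 f2 subgroup.mem_carrier[OF sA] by auto
  have [simp]: "a \<in> carrier G" "b \<in> carrier G" using zA unfolding Bl_def by auto
  define p where "p = int j - int i"
  have p0: "p > 0" unfolding p_def using ij by simp
  define h where "h = f2 \<otimes> inv f1"
  have hA: "h \<in> A" unfolding h_def using sA f1 f2 by (simp add: subgroup.m_closed subgroup.m_inv_closed)
  have [simp]: "h \<in> carrier G" unfolding h_def by simp
  have "g [^] p = g [^] int j \<otimes> inv (g [^] int i)"
    unfolding p_def using int_pow_mult[OF gc, of "int j" "- int i"] by (simp add: int_pow_neg)
  then have gp: "a \<otimes> h = g [^] p \<otimes> a"
    unfolding f1(2) f2(2) h_def by (simp add: m_assoc inv_mult_group)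
  have gpk: "a \<otimes> h [^] k = g [^] (p * k) \<otimes> a" for k :: int
    using intertwine_int_pow[OF _ _ _ gp, of k] by (simp add: int_pow_pow)
  obtain L where L: "\<And>v. v \<in> H \<Longrightarrow> \<exists>m::int. d \<one> (g [^] m \<otimes> v) \<le> L"
    using commens_subgroup_cobounded[OF g H gH all] by blast
  \<comment> \<open>Write \<open>v\<close> as a power of \<open>g\<close> times a short element and
    divide the exponent by \<open>p\<close>: the multiple of \<open>p\<close> is absorbed by
    \<open>A\<close>, and only the remainders and the short elements are left for
    \<open>T\<close>.\<close>
  define T where "T = (\<lambda>(r, y). inv a \<otimes> g [^] r \<otimes> y) ` ({0..<p} \<times> {y \<in> carrier G. d \<one> y \<le> L})"
  have "finite T" unfolding T_def using finite_ball by auto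
  moreover have "T \<subseteq> carrier G" unfolding T_def by auto
  moreover have "H \<subseteq> (a <# A) <#> T"
  proof
    fix v assume v: "v \<in> H"
    have [simp]: "v \<in> carrier G" by (rule subgroup.mem_carrier[OF H v])
    obtain m :: int where m: "d \<one> (g [^] m \<otimes> v) \<le> L" using L[OF v] by blast
    define k where "k = (- m) div p"
    define r where "r = (- m) mod p"
    have kr: "- m = p * k + r" "r \<in> {0..<p}" unfolding k_def r_def using p0 by auto
    have "v = g [^] (- m) \<otimes> (g [^] m \<otimes> v)" by (simp add: int_pow_neg)
    also have "g [^] (- m) = g [^] (p * k) \<otimes> g [^] r" unfolding kr(1) by (rule int_pow_mult[OF gc])
    also have "g [^] (p * k) = (a \<otimes> h [^] k) \<otimes> inv a" unfolding gpk by (simp add: m_assoc)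
    finally have "v = (a \<otimes> h [^] k) \<otimes> (inv a \<otimes> g [^] r \<otimes> (g [^] m \<otimes> v))" by (simp add: m_assoc)
    moreover have "a \<otimes> h [^] k \<in> a <# A"
      using subgroup_int_pow_closed[OF sA hA] unfolding l_coset_def by blast
    moreover have "inv a \<otimes> g [^] r \<otimes> (g [^] m \<otimes> v) \<in> T"
      unfolding T_def using kr(2) m by (intro image_eqI[of _ _ "(r, g [^] m \<otimes> v)"]) auto
    ultimately show "v \<in> (a <# A) <#> T" unfolding set_mult_def by blast
  qed
  ultimately show False using thin zA(1) \<open>a \<in> carrier G\<close> unfolding thin_def by blast
qed

text \<open>Writing \<open>e \<otimes> f \<otimes> b\<close> as
  \<open>(e \<otimes> f \<otimes> inv e) \<otimes> (e \<otimes> b)\<close> turns neighbourhoods of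
  short cosets into finitely many translates of conjugates of members. If these covered
  \<open>H\<close>, \<open>neumann_cover\<close> would let a single conjugate suffice, against
  \<open>thin\<close>.\<close>

lemma thin_escapes:
  assumes H: "subgroup H G" and fin: "finite \<F>" and sub: "\<And>F. F \<in> \<F> \<Longrightarrow> subgroup F G"
    and thin: "thin H \<F>"
  shows "\<exists>v\<in>H. \<not> near_member \<F> B v"
proof (rule ccontr)
  assume "\<not> ?thesis"
  then have near: "\<And>v. v \<in> H \<Longrightarrow> near_member \<F> B v" by blast
  define Bl where "Bl = {x \<in> carrier G. d \<one> x \<le> B}"
  have Bf: "finite Bl" unfolding Bl_def by (rule finite_ball)
  define conj where "conj = (\<lambda>(e, F). (\<lambda>f. e \<otimes> f \<otimes> inv e) ` F)"
  define K where "K = conj ` (Bl \<times> \<F>)"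
  define T where "T = (\<lambda>(e, b). e \<otimes> b) ` (Bl \<times> Bl)"
  have sK: "subgroup A G" if AK: "A \<in> K" for A
  proof -
    obtain z where "z \<in> Bl \<times> \<F>" and Az: "A = conj z" using AK unfolding K_def by blast
    then obtain e F where z: "z = (e, F)" and e: "e \<in> carrier G" "F \<in> \<F>"
      unfolding Bl_def by blast
    have A: "A = (\<lambda>f. e \<otimes> f \<otimes> inv e) ` F" unfolding Az z conj_def by simp
    have sF: "subgroup F G" using sub e by blast
    have Fc: "f \<in> carrier G" if "f \<in> F" for f using that subgroup.mem_carrier[OF sF] by blast
    show ?thesis
    proof (rule subgroupI)
      show "A \<subseteq> carrier G" unfolding A using e Fc by auto
      show "A \<noteq> {}" unfolding A using subgroup.one_closed[OF sF] by blast
      show "inv x \<in> A" if xA: "x \<in> A" for x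
      proof -
        obtain f where f: "f \<in> F" "x = e \<otimes> f \<otimes> inv e" using xA unfolding A by blast
        have "inv x = e \<otimes> inv f \<otimes> inv e" using f e Fc by (simp add: inv_mult_group m_assoc)
        then show ?thesis unfolding A using subgroup.m_inv_closed[OF sF f(1)] by blast
      qed
      show "x \<otimes> y \<in> A" if xy: "x \<in> A" "y \<in> A" for x y
      proof -
        obtain f f' where f: "f \<in> F" "x = e \<otimes> f \<otimes> inv e" "f' \<in> F" "y = e \<otimes> f' \<otimes> inv e"
          using xy unfolding A by blast
        have "x \<otimes> y = e \<otimes> (f \<otimes> f') \<otimes> inv e" using f e Fc by (simp add: m_assoc)
        then show ?thesis unfolding A using subgroup.m_closed[OF sF f(1) f(3)] by blast
      qed
    qed
  qed
  have "H \<subseteq> (\<Union>A\<in>K. A <#> T)"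
  proof
    fix v assume v: "v \<in> H"
    have vc [simp]: "v \<in> carrier G" by (rule subgroup.mem_carrier[OF H v])
    obtain F e f where F: "F \<in> \<F>" and e [simp]: "e \<in> carrier G" and f: "f \<in> F"
      and de: "d \<one> e \<le> B" and df: "d v (e \<otimes> f) \<le> B"
      using near[OF v] unfolding near_member_def by blast
    have [simp]: "f \<in> carrier G" using subgroup.mem_carrier[OF sub[OF F] f] by auto
    define b where "b = inv (e \<otimes> f) \<otimes> v"
    have "d \<one> b = d (e \<otimes> f) v"
      using d_left[of "inv (e \<otimes> f)" "e \<otimes> f" v] unfolding b_def by simp
    then have b: "b \<in> Bl" using df d_sym[of "e \<otimes> f" v] unfolding Bl_def b_def by simp
    then have [simp]: "b \<in> carrier G" unfolding Bl_def by simp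
    have "v = e \<otimes> f \<otimes> b" unfolding b_def by simp
    then have "v = (e \<otimes> f \<otimes> inv e) \<otimes> (e \<otimes> b)" by (simp add: m_assoc)
    moreover have "e \<otimes> f \<otimes> inv e \<in> conj (e, F)" unfolding conj_def using f by auto
    moreover have "conj (e, F) \<in> K" unfolding K_def using F de unfolding Bl_def by auto
    moreover have "e \<otimes> b \<in> T" unfolding T_def using b de unfolding Bl_def by auto
    ultimately show "v \<in> (\<Union>A\<in>K. A <#> T)" unfolding set_mult_def by blast
  qed
  moreover have "finite K" "finite T" unfolding K_def T_def using Bf fin by auto
  moreover have "T \<subseteq> carrier G" unfolding T_def Bl_def by auto
  ultimately obtain A T' where A: "A \<in> K" and T': "finite T'" "T' \<subseteq> carrier G" "H \<subseteq> A <#> T'"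
    using neumann_cover[of K H T] sK H by blast
  obtain z where "z \<in> Bl \<times> \<F>" and Az: "A = conj z" using A unfolding K_def by blast
  then obtain e F where z: "z = (e, F)" and e [simp]: "e \<in> carrier G" and F: "F \<in> \<F>"
    unfolding Bl_def by blast
  have Ae: "A = (\<lambda>f. e \<otimes> f \<otimes> inv e) ` F" unfolding Az z conj_def by simp
  have "H \<subseteq> (e <# F) <#> ((\<lambda>t. inv e \<otimes> t) ` T')"
  proof
    fix v assume "v \<in> H"
    then obtain f t where f: "f \<in> F" "t \<in> T'" "v = e \<otimes> f \<otimes> inv e \<otimes> t"
      using T'(3) unfolding Ae set_mult_def by blast
    have "f \<in> carrier G" "t \<in> carrier G" using f T' subgroup.mem_carrier[OF sub[OF F]] by auto
    then have "v = (e \<otimes> f) \<otimes> (inv e \<otimes> t)" using f by (simp add: m_assoc)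
    then show "v \<in> (e <# F) <#> ((\<lambda>t. inv e \<otimes> t) ` T')"
      using f unfolding set_mult_def l_coset_def by blast
  qed
  moreover have "(\<lambda>t. inv e \<otimes> t) ` T' \<subseteq> carrier G" using T' by auto
  ultimately show False using thin F T'(1) e unfolding thin_def by blast
qed

text \<open>In \<open>w = v \<otimes> a \<otimes> y \<otimes> c\<close> the factors \<open>a\<close>
  and \<open>c\<close> are powers of \<open>g\<close>, and \<open>y\<close> is a conjugate power
  with different ends. The factor \<open>y\<close> keeps \<open>a\<close> and \<open>c\<close> from
  cancelling, so their signs can be chosen independently. All turns are bounded by \<open>M\<close>,
  which depends on \<open>g\<close> and \<open>t\<close> only; the radius \<open>B\<close>
  influences only \<open>v\<close>.\<close>

lemma escaping_lox_if_not_commens: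
  assumes g: "lox g C" and H: "subgroup H G" and gH: "g \<in> H" and tH: "t \<in> H" and nc: "\<not> commens g t"
    and Fs: "\<forall>F\<in>\<F>. qc \<eta> F" and ne: "\<F> \<noteq> {}" and fin: "finite \<F>" and thin: "thin H \<F>"
  shows "\<exists>C'. \<forall>B. \<exists>w\<in>H. lox w C' \<and> \<not> near_member \<F> B w"
proof -
  have gc [simp]: "g \<in> carrier G" using g lox_carrier by simp
  have tc [simp]: "t \<in> carrier G" by (rule subgroup.mem_carrier[OF H tH])
  have sub: "subgroup F G" if "F \<in> \<F>" for F using bspec[OF Fs that] unfolding qc_def by simp
  obtain M0 where M0: "\<forall>(n::int) (m::int). gp \<one> (t \<otimes> g [^] n \<otimes> inv t) (g [^] m) \<le> M0"
    using not_commens_bounded[OF g tc nc] by (elim exE) (rule that; assumption)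
  define M where "M = max M0 (C + 3 * \<delta>)"
  have M: "gp \<one> (t \<otimes> g [^] n \<otimes> inv t) (g [^] m) \<le> M" for n m :: int
    using M0 unfolding M_def by (meson max.coboundedI1)
  have MC: "C + 3 * \<delta> \<le> M" unfolding M_def by simp
  have M_nonneg: "M \<ge> 0" using MC lox_nonneg[OF g] delta_nonneg by linarith
  define N where "N = int (nat \<lceil>2 * M + 10 * \<delta> + 1\<rceil>)"
  have N: "real_of_int N \<ge> 2 * M + 10 * \<delta> + 1" "N \<ge> 0" unfolding N_def by linarith+
  \<comment> \<open>Conjugation by \<open>t\<close> can shorten a power by
    \<open>2 * d \<one> t\<close>; the larger exponent compensates for this.\<close>
  define N' where "N' = N + int (nat \<lceil>2 * d \<one> t\<rceil>)"
  have N': "real_of_int N' \<ge> real_of_int N + 2 * d \<one> t" unfolding N'_def by linarith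
  define y where "y = t \<otimes> g [^] N' \<otimes> inv t"
  have [simp]: "y \<in> carrier G" unfolding y_def by simp
  have y_inv: "inv y = t \<otimes> g [^] (- N') \<otimes> inv t"
    unfolding y_def by (simp add: inv_mult_group m_assoc int_pow_neg)
  have gNH: "g [^] (k::int) \<in> H" for k by (rule subgroup_int_pow_closed[OF H gH])
  have yH: "y \<in> H" unfolding y_def
    using H tH gNH by (intro subgroup.m_closed[OF H] subgroup.m_inv_closed[OF H])
  have "d \<one> (g [^] N') \<le> d \<one> (inv t) + d \<one> (y \<otimes> t)"
    using d_one_mult[of "inv t" "y \<otimes> t"] unfolding y_def by (simp add: m_assoc)
  then have y_len: "d \<one> y \<ge> real_of_int N"
    using d_one_mult[of y t] lox_growth[OF g, of N'] N' by (simp add: d_inv)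
  have "\<exists>w\<in>H. lox w (M + \<delta> + \<delta>) \<and> \<not> near_member \<F> B w" for B
  proof -
    \<comment> \<open>The three entries keep \<open>e\<close> admissible, force \<open>v\<close> to
      be long, and absorb the loss of \<open>coset_convex\<close> when closeness to a coset passes
      from \<open>w\<close> to \<open>v\<close>.\<close>
    define B1 where "B1 = max B (max (2 * M + 10 * \<delta> + 1) ((M + \<delta>) + 2 * B + 2 * \<delta> + 1 + \<eta>))"
    obtain v where v: "v \<in> H" and vB: "\<not> near_member \<F> B1 v"
      using thin_escapes[OF H fin sub thin] by blast
    have [simp]: "v \<in> carrier G" by (rule subgroup.mem_carrier[OF H v])
    have v_len: "d \<one> v > 2 * M + 10 * \<delta> + 1"
    proof (rule ccontr)
      assume "\<not> ?thesis"
      then have le: "d \<one> v \<le> B1" unfolding B1_def by simp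
      obtain F where F: "F \<in> \<F>" using ne by blast
      have B10: "0 \<le> B1" using le d_nonneg[of \<one> v] by linarith
      have "d \<one> \<one> \<le> B1 \<and> d v (\<one> \<otimes> \<one>) \<le> B1" using le B10 d_sym[of v \<one>] by simp
      then have "near_member \<F> B1 v"
        unfolding near_member_def using F subgroup.one_closed[OF sub[OF F]] one_closed by blast
      then show False using vB by simp
    qed
    \<comment> \<open>The sign of \<open>k\<close> prevents backtracking between \<open>v\<close>
      and \<open>a\<close>; that of \<open>l\<close> prevents it between the final \<open>c\<close>
      and the initial \<open>v\<close> of the next copy of \<open>w\<close>.\<close>
    obtain k :: int where k: "\<bar>k\<bar> = N" and gk: "gp \<one> (inv v) (g [^] k) \<le> M"
      using lox_sign[OF g, of "inv v" N] N(2) MC that[of N] that[of "- N"] by auto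
    obtain l :: int where l: "\<bar>l\<bar> = N" and gl: "gp \<one> v (g [^] (- l)) \<le> M"
      using lox_sign[OF g, of v N] N(2) MC that[of N] that[of "- N"] by auto
    define a where "a = g [^] k"
    define c where "c = g [^] l"
    have [simp]: "a \<in> carrier G" "c \<in> carrier G" unfolding a_def c_def by auto
    have a_len: "d \<one> a \<ge> real_of_int N" unfolding a_def using lox_growth[OF g, of k] k by simp
    have c_len: "d \<one> c \<ge> real_of_int N" unfolding c_def using lox_growth[OF g, of l] l by simp
    define w where "w = v \<otimes> a \<otimes> y \<otimes> c"
    have wc [simp]: "w \<in> carrier G" unfolding w_def by simp
    have wH: "w \<in> H" unfolding w_def a_def c_def
      using v gNH yH by (intro subgroup.m_closed[OF H])
    have turn_c: "gp \<one> (inv c) v \<le> M"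
      using gl gp_sym[of v "g [^] (- l)" \<one>] unfolding c_def by (simp add: int_pow_neg)
    have turn_v: "gp v \<one> (v \<otimes> a) \<le> M"
      using gk gp_left[of v "inv v" a \<one>] unfolding a_def[symmetric] by simp
    have "gp \<one> (inv a) y \<le> M"
      using M[of N' "- k"] gp_sym[of y "inv a" \<one>] unfolding a_def y_def by (simp add: int_pow_neg)
    then have turn_a: "gp (v \<otimes> a) v (v \<otimes> a \<otimes> y) \<le> M"
      using gp_left[of "v \<otimes> a" "inv a" y \<one>] by (simp add: m_assoc)
    have "gp \<one> (inv y) c \<le> M" using M[of "- N'" l] unfolding y_inv c_def by simp
    then have turn_y: "gp (v \<otimes> a \<otimes> y) (v \<otimes> a) w \<le> M"
      using gp_left[of "v \<otimes> a \<otimes> y" "inv y" c \<one>] unfolding w_def by (simp add: m_assoc)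
    have len_v: "d \<one> v > 2 * M + 3 * \<delta>" using v_len delta_nonneg by linarith
    have len_a: "d v (v \<otimes> a) > 2 * M + 3 * \<delta>"
      using a_len N d_left[of v \<one> a] delta_nonneg by simp
    have len_y: "d (v \<otimes> a) (v \<otimes> a \<otimes> y) > 2 * M + 3 * \<delta>"
      using y_len N d_left[of "v \<otimes> a" \<one> y] delta_nonneg by simp
    have len_c: "d (v \<otimes> a \<otimes> y) w > 2 * M + 3 * \<delta>"
      using c_len N d_left[of "v \<otimes> a \<otimes> y" \<one> c] delta_nonneg unfolding w_def by simp
    \<comment> \<open>Small turns are propagated along the line, first looking ahead to
      \<open>w\<close> and then, from \<open>b1\<close> on, looking back to the unit. Translating
      the latter by \<open>inv w\<close> and joining both at the unit bounds the turn between
      \<open>inv w\<close> and \<open>w\<close>.\<close>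
    have f1: "gp (v \<otimes> a) v w \<le> M + \<delta>"
      by (rule gp_concat[OF _ _ _ _ turn_a turn_y]) (use len_y delta_nonneg in auto)
    have f2: "gp v \<one> w \<le> M + \<delta>"
      by (rule gp_concat[OF _ _ _ _ turn_v f1]) (use len_a delta_nonneg in auto)
    have f3: "gp \<one> (inv c) w \<le> M + \<delta>"
      by (rule gp_concat[OF _ _ _ _ turn_c f2]) (use len_v delta_nonneg in auto)
    have turn_a': "gp (v \<otimes> a) (v \<otimes> a \<otimes> y) v \<le> M"
      using turn_a gp_sym[of v "v \<otimes> a \<otimes> y" "v \<otimes> a"] by simp
    have turn_v': "gp v (v \<otimes> a) \<one> \<le> M" using turn_v gp_sym[of \<one> "v \<otimes> a" v] by simp
    have turn_y': "gp (v \<otimes> a \<otimes> y) w (v \<otimes> a) \<le> M"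
      using turn_y gp_sym[of "v \<otimes> a" w "v \<otimes> a \<otimes> y"] by simp
    have b1: "gp (v \<otimes> a) (v \<otimes> a \<otimes> y) \<one> \<le> M + \<delta>"
      by (rule gp_concat[OF _ _ _ _ turn_a' turn_v']) (use len_a d_sym[of v "v \<otimes> a"] delta_nonneg in auto)
    have b2: "gp (v \<otimes> a \<otimes> y) w \<one> \<le> M + \<delta>"
      by (rule gp_concat[OF _ _ _ _ turn_y' b1])
        (use len_y d_sym[of "v \<otimes> a" "v \<otimes> a \<otimes> y"] delta_nonneg in auto)
    have ic: "w \<otimes> inv c = v \<otimes> a \<otimes> y" unfolding w_def by (simp add: m_assoc)
    have b3: "gp (inv c) \<one> (inv w) \<le> M + \<delta>"
      using b2 gp_left[of w \<one> "inv w" "inv c"] ic by simp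
    have f3': "gp \<one> w (inv c) \<le> M + \<delta>" using f3 gp_sym[of "inv c" w \<one>] by simp
    have "gp \<one> w (inv w) \<le> (M + \<delta>) + \<delta>"
      by (rule gp_concat[OF _ _ _ _ f3' b3]) (use c_len N delta_nonneg in \<open>auto simp: d_inv\<close>)
    then have w_turn: "gp \<one> (inv w) w \<le> M + \<delta> + \<delta>" using gp_sym[of w "inv w" \<one>] by simp
    have "d \<one> v - (M + \<delta>) \<le> gp \<one> v w" using f2 gp_swap[of \<one> v w] d_sym[of v \<one>] by simp
    moreover have "gp \<one> v w \<le> (d \<one> v + d \<one> w - d v w) / 2" unfolding gp_def by simp
    moreover have "d v w \<ge> 2 * M + 9 * \<delta> + 1"
    proof -
      have "d v w = d v (v \<otimes> a) + d (v \<otimes> a) w - 2 * gp (v \<otimes> a) v w"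
        unfolding gp_def using d_sym[of v "v \<otimes> a"] by (simp add: field_simps)
      moreover have "d (v \<otimes> a) w = d (v \<otimes> a) (v \<otimes> a \<otimes> y) + d (v \<otimes> a \<otimes> y) w - 2 * gp (v \<otimes> a \<otimes> y) (v \<otimes> a) w"
        unfolding gp_def using d_sym[of "v \<otimes> a" "v \<otimes> a \<otimes> y"] by (simp add: field_simps)
      moreover have "d v (v \<otimes> a) \<ge> 2 * M + 10 * \<delta> + 1" "d (v \<otimes> a) (v \<otimes> a \<otimes> y) \<ge> 2 * M + 10 * \<delta> + 1"
        "d (v \<otimes> a \<otimes> y) w \<ge> 2 * M + 10 * \<delta> + 1"
        using a_len y_len c_len N d_left[of v \<one> a] d_left[of "v \<otimes> a" \<one> y]
          d_left[of "v \<otimes> a \<otimes> y" \<one> c] unfolding w_def by auto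
      ultimately show ?thesis using f1 turn_y M_nonneg delta_nonneg by linarith
    qed
    ultimately have "d \<one> w \<ge> 2 * (M + \<delta> + \<delta>) + 4 * \<delta> + 1"
      using v_len delta_nonneg M_nonneg by simp
    then have "lox w (M + \<delta> + \<delta>)" unfolding lox_def using w_turn by simp
    moreover have "\<not> near_member \<F> B w"
    proof
      assume "near_member \<F> B w"
      \<comment> \<open>Both the unit and \<open>w\<close> would be near the coset of
        \<open>e\<close>, and \<open>v\<close> lies coarsely between them.\<close>
      then obtain F e f where F: "F \<in> \<F>" and e: "e \<in> carrier G" and f: "f \<in> F"
        and de: "d \<one> e \<le> B" and df: "d w (e \<otimes> f) \<le> B"
        unfolding near_member_def by blast
      have "\<exists>b\<in>F. d v (e \<otimes> b) \<le> (M + \<delta>) + 2 * B + 2 * \<delta> + 1 + \<eta>"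
        by (rule coset_convex[OF bspec[OF Fs F] e _ _ _ subgroup.one_closed[OF sub[OF F]] f _ df f2])
          (use de e in auto)
      then obtain b where b: "b \<in> F" "d v (e \<otimes> b) \<le> B1" unfolding B1_def by fastforce
      have "d \<one> e \<le> B1" using de unfolding B1_def by simp
      then have "near_member \<F> B1 v" unfolding near_member_def using F e b by blast
      then show False using vB by simp
    qed
    ultimately show ?thesis using wH by blast
  qed
  then show ?thesis by blast
qed

lemma escaping_lox:
  assumes H: "subgroup H G" and Fs: "\<forall>F\<in>\<F>. qc \<eta> F" and ne: "\<F> \<noteq> {}" and fin: "finite \<F>"
    and thin: "thin H \<F>"
  shows "\<exists>C. \<forall>B. \<exists>w\<in>H. lox w C \<and> \<not> near_member \<F> B w"
proof -
  have Hc: "H \<subseteq> carrier G" using H by (rule subgroup.subset)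
  have sub: "subgroup F G" if "F \<in> \<F>" for F using bspec[OF Fs that] unfolding qc_def by simp
  have "infinite H"
  proof
    assume fH: "finite H"
    obtain F where F: "F \<in> \<F>" using ne by blast
    have "H \<subseteq> (\<one> <# F) <#> H"
    proof
      fix h assume h: "h \<in> H"
      have "h = (\<one> \<otimes> \<one>) \<otimes> h" using h Hc by auto
      then show "h \<in> (\<one> <# F) <#> H"
        using h subgroup.one_closed[OF sub[OF F]] unfolding set_mult_def l_coset_def by blast
    qed
    then show False using thin F fH Hc one_closed unfolding thin_def by blast
  qed
  then obtain g C where gH: "g \<in> H" and g: "lox g C" using infinite_subgroup_lox[OF H] by blast
  have gc [simp]: "g \<in> carrier G" using g lox_carrier by simp
  show ?thesis
  proof (cases "\<forall>t\<in>H. commens g t")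
    case False
    then obtain t where "t \<in> H" "\<not> commens g t" by blast
    then show ?thesis using escaping_lox_if_not_commens[OF g H gH _ _ Fs ne fin thin] by blast
  next
    case True
    \<comment> \<open>High powers of \<open>g\<close> satisfy \<open>lox\<close> with a constant
      independent of the exponent, as needed for a uniform \<open>C\<close>.\<close>
    define N where "N = nat \<lceil>2 * (C + 2 * \<delta>) + 4 * \<delta> + 1\<rceil>"
    have "\<exists>w\<in>H. lox w (C + 2 * \<delta>) \<and> \<not> near_member \<F> B w" for B
    proof -
      obtain n where n: "n \<ge> N" "\<not> near_member \<F> B (g [^] int n)"
        using commens_power_escapes[OF g H gH _ fin sub thin] True by blast
      have "gp \<one> (g [^] (- int n)) (g [^] int n) \<le> C + 2 * \<delta>"
        using lox_powers[OF g, of "- int n" 0 "int n"] by simp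
      moreover have "d \<one> (g [^] int n) \<ge> 2 * (C + 2 * \<delta>) + 4 * \<delta> + 1"
        using lox_growth[OF g, of "int n"] n(1) unfolding N_def by simp linarith
      ultimately have "lox (g [^] int n) (C + 2 * \<delta>)" unfolding lox_def by (simp add: int_pow_neg)
      then show ?thesis using n(2) subgroup_int_pow_closed[OF H gH] by blast
    qed
    then show ?thesis by blast
  qed
qed

text \<open>The order of choices matters: \<open>C\<close> comes first, \<open>R\<close> is computed
  from it, and only then is \<open>w\<close> taken outside the resulting radius.\<close>

theorem thin_not_subset_prod_pow:
  assumes H: "subgroup H G" and Fs: "\<forall>F\<in>\<F>. qc \<eta> F" and ne: "\<F> \<noteq> {}" and fin: "finite \<F>"
    and thin: "thin H \<F>" and D: "D \<ge> 0" "\<eta> \<ge> 0"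
  shows "\<not> H \<subseteq> prod_pow (\<Union>\<F> \<union> {y \<in> carrier G. d \<one> y \<le> D}) n"
proof -
  obtain C where C: "\<forall>B. \<exists>w\<in>H. lox w C \<and> \<not> near_member \<F> B w"
    using escaping_lox[OF H Fs ne fin thin] by (elim exE) (rule that; assumption)
  define R where "R = (C + 2 * \<delta>) + real n * \<delta> + 2 * \<delta> + 1 + \<eta> + D"
  obtain w where "w \<in> H" "lox w C" "\<not> near_member \<F> ((C + 2 * \<delta>) + 2 * R + 2 * \<delta> + 1 + \<eta>) w"
    using C by blast
  then show ?thesis
    using lox_power_escapes[OF Fs ne D _ R_def] subgroup_int_pow_closed[OF H] by blast
qed

section \<open>Arithmetic of product sets\<close>

lemma prod_pow_mult:
  assumes U: "U \<subseteq> carrier G" and x: "x \<in> prod_pow U n" and y: "y \<in> prod_pow U m"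
  shows "x \<otimes> y \<in> prod_pow U (n + m)"
  using y
proof (induction m arbitrary: y)
  case 0
  then show ?case using x subsetD[OF prod_pow_carrier[OF U] x] by simp
next
  case (Suc m)
  then obtain z u where z: "z \<in> prod_pow U m" "u \<in> U" "y = z \<otimes> u" by (auto simp: set_mult_def)
  have c: "x \<in> carrier G" "z \<in> carrier G" "u \<in> carrier G"
    using x z U prod_pow_carrier[OF U] by auto
  have "x \<otimes> y = (x \<otimes> z) \<otimes> u" using z c by (simp add: m_assoc)
  then show ?case using Suc.IH[OF z(1)] z(2) by (auto simp: set_mult_def)
qed

lemma prod_pow_one: "U \<subseteq> carrier G \<Longrightarrow> u \<in> U \<Longrightarrow> u \<in> prod_pow U (Suc 0)"
  using subsetD[of U "carrier G" u] by (auto simp: set_mult_def intro!: bexI[of _ u])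

lemma prod_pow_mono:
  assumes "U \<subseteq> carrier G" "\<one> \<in> U" "n \<le> m"
  shows "prod_pow U n \<subseteq> prod_pow U m"
proof (rule lift_Suc_mono_le[OF _ assms(3)])
  show "prod_pow U k \<subseteq> prod_pow U (Suc k)" for k
    using assms(2) prod_pow_carrier[OF assms(1), of k] by (force simp: set_mult_def)
qed

lemma prod_pow_inv:
  assumes U: "U \<subseteq> carrier G" and i: "\<And>u. u \<in> U \<Longrightarrow> inv u \<in> U" and x: "x \<in> prod_pow U n"
  shows "inv x \<in> prod_pow U n"
  using x
proof (induction n arbitrary: x)
  case (Suc n)
  then obtain z u where z: "z \<in> prod_pow U n" "u \<in> U" "x = z \<otimes> u" by (auto simp: set_mult_def)
  have c: "z \<in> carrier G" "u \<in> carrier G" using z U prod_pow_carrier[OF U] by auto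
  have "inv x = inv u \<otimes> inv z" using z c by (simp add: inv_mult_group)
  then show ?case
    using prod_pow_mult[OF U prod_pow_one[OF U i[OF z(2)]] Suc.IH[OF z(1)]] by simp
qed simp

lemma foldl_product_prod_pow:
  assumes U: "U \<subseteq> carrier G" and fs: "\<forall>(F, g)\<in>set fs. F \<subseteq> U \<and> g \<in> U" and A: "A \<subseteq> prod_pow U n"
  shows "foldl (\<lambda>A (F, g). (A <#> F) #> g) A fs \<subseteq> prod_pow U (n + 2 * length fs)"
  using fs A
proof (induction fs arbitrary: A n)
  case (Cons a fs)
  obtain F g where a: "a = (F, g)" by fastforce
  have "(A <#> F) #> g \<subseteq> prod_pow U (Suc (Suc n))"
    using Cons.prems unfolding a by (auto simp: set_mult_def r_coset_def)
  then show ?case using Cons.IH[of "(A <#> F) #> g" "Suc (Suc n)"] Cons.prems unfolding a by simp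
qed simp

end

subsection \<open>The word metric\<close>

text \<open>Fixing the number of edges permits induction on it, so that later arguments need not
  handle vertex lists.\<close>

definition reach :: "('a, 'b) monoid_scheme \<Rightarrow> 'a set \<Rightarrow> nat \<Rightarrow> 'a \<Rightarrow> 'a \<Rightarrow> bool" where
  "reach G S n x y \<longleftrightarrow> (\<exists>xs. cayley_walk G S x xs y \<and> length xs = Suc n)"

lemma word_dist_reach: "word_dist G S x y = (LEAST n. reach G S n x y)"
  unfolding word_dist_def reach_def by simp

lemma cayley_walk_append:
  assumes "cayley_walk G S x xs y" "cayley_walk G S y ys z"
  shows "cayley_walk G S x (xs @ tl ys) z"
proof -
  obtain zs where ys: "ys = y # zs" using assms(2) unfolding cayley_walk_def by (cases ys) auto
  show ?thesis using assms unfolding ys cayley_walk_def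
    by (cases zs) (auto simp: successively_append_iff)
qed

lemma reach_0: "reach G S 0 x y \<longleftrightarrow> x = y \<and> x \<in> carrier G"
  unfolding reach_def cayley_walk_def by (auto simp: length_Suc_conv intro!: exI[of _ "[y]"])

lemma reach_trans:
  assumes "reach G S n x y" "reach G S m y z"
  shows "reach G S (n + m) x z"
proof -
  obtain xs ys where xs: "cayley_walk G S x xs y" "length xs = Suc n"
    and ys: "cayley_walk G S y ys z" "length ys = Suc m"
    using assms unfolding reach_def by blast
  show ?thesis unfolding reach_def using cayley_walk_append[OF xs(1) ys(1)] xs(2) ys(2)
    by (intro exI[of _ "xs @ tl ys"]) simp
qed

lemma reach_Suc: "reach G S (Suc n) x y \<longleftrightarrow> y \<in> carrier G \<and> (\<exists>z. reach G S n x z \<and> cayley_adj G S z y)"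
proof
  assume "reach G S (Suc n) x y"
  then obtain xs where xs: "cayley_walk G S x xs y" "length xs = Suc (Suc n)" unfolding reach_def by blast
  then obtain ys where ys: "xs = ys @ [y]" "length ys = Suc n"
    unfolding cayley_walk_def by (metis append_butlast_last_id length_butlast diff_Suc_1)
  then have ne: "ys \<noteq> []" by auto
  then have "cayley_walk G S x ys (last ys) \<and> cayley_adj G S (last ys) y \<and> y \<in> carrier G"
    using xs(1) unfolding ys(1) cayley_walk_def by (auto simp: successively_append_iff)
  then show "y \<in> carrier G \<and> (\<exists>z. reach G S n x z \<and> cayley_adj G S z y)"
    using ys(2) unfolding reach_def by blast
next
  assume "y \<in> carrier G \<and> (\<exists>z. reach G S n x z \<and> cayley_adj G S z y)"
  then obtain z ys where y: "y \<in> carrier G" and ys: "cayley_walk G S x ys z" "length ys = Suc n"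
    and a: "cayley_adj G S z y" unfolding reach_def by blast
  then have "cayley_walk G S x (ys @ [y]) y"
    unfolding cayley_walk_def by (auto simp: successively_append_iff)
  then show "reach G S (Suc n) x y" unfolding reach_def using ys(2) by (intro exI[of _ "ys @ [y]"]) simp
qed

lemma reach_split: "reach G S (n + m) x z \<Longrightarrow> \<exists>y. reach G S n x y \<and> reach G S m y z"
proof (induction m arbitrary: z)
  case 0
  then have "z \<in> carrier G" by (cases n) (auto simp: reach_0 reach_Suc)
  then show ?case using 0 by (auto simp: reach_0)
next
  case (Suc m)
  then show ?case by (simp add: reach_Suc) blast
qed

lemma reach_carrier: "reach G S n x y \<Longrightarrow> x \<in> carrier G \<and> y \<in> carrier G"
proof (induction n arbitrary: y)
  case (Suc n)
  then show ?case unfolding reach_Suc by blast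
qed (simp add: reach_0)

context
  fixes G (structure) and S
  assumes G: "group G" and S: "symmetric_generating_set G S"
begin

interpretation group G by (rule G)

lemma S_carrier: "s \<in> S \<Longrightarrow> s \<in> carrier G"
  using S unfolding symmetric_generating_set_def by blast

lemma reach_left:
  assumes a: "a \<in> carrier G"
  shows "reach G S n x y \<Longrightarrow> reach G S n (a \<otimes> x) (a \<otimes> y)"
proof (induction n arbitrary: y)
  case (Suc n)
  then obtain z where z: "reach G S n x z" "cayley_adj G S z y" "y \<in> carrier G" unfolding reach_Suc by blast
  then obtain s where s: "s \<in> S" "y = z \<otimes> s" unfolding cayley_adj_def by blast
  have "a \<otimes> y = a \<otimes> z \<otimes> s" using s a reach_carrier[OF z(1)] S_carrier by (simp add: m_assoc)
  then have "cayley_adj G S (a \<otimes> z) (a \<otimes> y)" unfolding cayley_adj_def using s by blast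
  then show ?case unfolding reach_Suc using Suc.IH[OF z(1)] a z(3) by blast
qed (use a in \<open>simp add: reach_0\<close>)

lemma reach_sym: "reach G S n x y \<Longrightarrow> reach G S n y x"
proof (induction n arbitrary: y)
  case (Suc n)
  then obtain z where z: "reach G S n x z" "cayley_adj G S z y" "y \<in> carrier G" unfolding reach_Suc by blast
  then obtain s where s: "s \<in> S" "y = z \<otimes> s" unfolding cayley_adj_def by blast
  have "inv s \<in> S" using S s unfolding symmetric_generating_set_def by blast
  moreover have "z = y \<otimes> inv s" using s reach_carrier[OF z(1)] S_carrier by (simp add: m_assoc)
  ultimately have "cayley_adj G S y z" unfolding cayley_adj_def by blast
  then have "reach G S (Suc 0) y z"
    unfolding reach_Suc using z(3) reach_carrier[OF z(1)] by (auto simp: reach_0)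
  then show ?case using reach_trans[OF _ Suc.IH[OF z(1)]] by fastforce
qed (simp add: reach_0)

lemma reach_generate: "g \<in> generate G S \<Longrightarrow> \<exists>n. reach G S n \<one> g"
proof (induction rule: generate.induct)
  case one
  then show ?case by (intro exI[of _ 0]) (simp add: reach_0)
next
  case (incl s)
  then have "reach G S (Suc 0) \<one> s"
    unfolding reach_Suc cayley_adj_def using S_carrier by (force simp: reach_0)
  then show ?case by blast
next
  case (inv s)
  then have "inv s \<in> S" using S unfolding symmetric_generating_set_def by blast
  then have "reach G S (Suc 0) \<one> (inv s)"
    unfolding reach_Suc cayley_adj_def using S_carrier by (force simp: reach_0)
  then show ?case by blast
next
  case (eng g h)
  then obtain n m where n: "reach G S n \<one> g" and m: "reach G S m \<one> h" by blast
  have "g \<in> carrier G" using reach_carrier[OF n] by simp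
  then have "reach G S m g (g \<otimes> h)" using reach_left[OF _ m, of g] by simp
  then show ?case using reach_trans[OF n] by blast
qed

lemma reach_ex:
  assumes "x \<in> carrier G" "y \<in> carrier G"
  shows "\<exists>n. reach G S n x y"
proof -
  have "inv x \<otimes> y \<in> generate G S" using assms S unfolding symmetric_generating_set_def by simp
  then obtain n where "reach G S n \<one> (inv x \<otimes> y)" using reach_generate by blast
  then show ?thesis using reach_left[OF assms(1), of n \<one> "inv x \<otimes> y"] assms by auto
qed

lemma reach_word_dist: "x \<in> carrier G \<Longrightarrow> y \<in> carrier G \<Longrightarrow> reach G S (word_dist G S x y) x y"
  unfolding word_dist_reach using reach_ex by (rule LeastI_ex)

lemma word_dist_le: "reach G S n x y \<Longrightarrow> word_dist G S x y \<le> n"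
  unfolding word_dist_reach by (rule Least_le)

lemma word_dist_sym:
  assumes "x \<in> carrier G" "y \<in> carrier G"
  shows "word_dist G S x y = word_dist G S y x"
  using word_dist_le[OF reach_sym[OF reach_word_dist]] assms by (simp add: order_antisym)

lemma word_dist_tri:
  assumes "x \<in> carrier G" "y \<in> carrier G" "z \<in> carrier G"
  shows "word_dist G S x z \<le> word_dist G S x y + word_dist G S y z"
  using word_dist_le[OF reach_trans[OF reach_word_dist reach_word_dist]] assms by blast

lemma word_dist_left:
  assumes a: "a \<in> carrier G" and x: "x \<in> carrier G" and y: "y \<in> carrier G"
  shows "word_dist G S (a \<otimes> x) (a \<otimes> y) = word_dist G S x y"
proof (rule antisym)
  show "word_dist G S (a \<otimes> x) (a \<otimes> y) \<le> word_dist G S x y"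
    by (rule word_dist_le[OF reach_left[OF a reach_word_dist[OF x y]]])
  have "reach G S (word_dist G S (a \<otimes> x) (a \<otimes> y)) (inv a \<otimes> (a \<otimes> x)) (inv a \<otimes> (a \<otimes> y))"
    using a x y by (intro reach_left reach_word_dist) auto
  then show "word_dist G S x y \<le> word_dist G S (a \<otimes> x) (a \<otimes> y)"
    using a x y by (simp add: word_dist_le)
qed

lemma finite_reach: "finite {y. reach G S n x y}"
proof (induction n)
  case 0
  show ?case by (rule finite_subset[of _ "{x}"]) (auto simp: reach_0)
next
  case (Suc n)
  have "{y. reach G S (Suc n) x y} \<subseteq> (\<lambda>(z, s). z \<otimes> s) ` ({z. reach G S n x z} \<times> S)"
    unfolding reach_Suc cayley_adj_def by auto
  moreover have "finite S" using S unfolding symmetric_generating_set_def by blast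
  ultimately show ?case using Suc finite_subset by (metis finite_SigmaI finite_imageI)
qed

lemma finite_word_ball: "finite {x \<in> carrier G. real (word_dist G S \<one> x) \<le> r}"
proof (rule finite_subset)
  show "{x \<in> carrier G. real (word_dist G S \<one> x) \<le> r} \<subseteq> (\<Union>n\<le>nat \<lfloor>r\<rfloor>. {y. reach G S n \<one> y})"
  proof
    fix x assume "x \<in> {x \<in> carrier G. real (word_dist G S \<one> x) \<le> r}"
    then have "x \<in> carrier G" "word_dist G S \<one> x \<le> nat \<lfloor>r\<rfloor>" by (auto simp: le_nat_floor)
    then show "x \<in> (\<Union>n\<le>nat \<lfloor>r\<rfloor>. {y. reach G S n \<one> y})" using reach_word_dist by blast
  qed
  show "finite (\<Union>n\<le>nat \<lfloor>r\<rfloor>. {y. reach G S n \<one> y})" using finite_reach by blast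
qed

text \<open>Cut a shortest walk after \<open>n\<close> edges; the triangle inequality forces both
  pieces to be shortest.\<close>

lemma word_dist_geod:
  assumes x: "x \<in> carrier G" and y: "y \<in> carrier G" and n: "n \<le> word_dist G S x y"
  shows "\<exists>p\<in>carrier G. word_dist G S x p = n \<and> word_dist G S p y = word_dist G S x y - n"
proof -
  obtain m where m: "word_dist G S x y = n + m" using n le_Suc_ex by blast
  have "reach G S (n + m) x y" using reach_word_dist[OF x y] unfolding m .
  then obtain p where p: "reach G S n x p" "reach G S m p y"
    using reach_split[of G S n m x y] by blast
  have pc: "p \<in> carrier G" using reach_carrier[OF p(1)] by simp
  have "word_dist G S x p \<le> n" "word_dist G S p y \<le> m" using p by (auto simp: word_dist_le)
  then show ?thesis using word_dist_tri[OF x pc y] m pc by (intro bexI[of _ p]) auto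
qed

text \<open>Joining shortest walks to and from \<open>p\<close> gives a walk of minimal length. This
  connects the metric condition in \<open>qc\<close> with the vertex lists in
  \<open>quasiconvex\<close>.\<close>

lemma geodesic_through:
  assumes c: "x \<in> carrier G" "p \<in> carrier G" "y \<in> carrier G"
    and e: "word_dist G S x p + word_dist G S p y = word_dist G S x y"
  shows "\<exists>xs. cayley_geodesic G S x xs y \<and> p \<in> set xs"
proof -
  obtain xs ys where xs: "cayley_walk G S x xs p" "length xs = Suc (word_dist G S x p)"
    and ys: "cayley_walk G S p ys y" "length ys = Suc (word_dist G S p y)"
    using reach_word_dist[OF c(1,2)] reach_word_dist[OF c(2,3)] unfolding reach_def by blast
  have "cayley_geodesic G S x (xs @ tl ys) y"
    unfolding cayley_geodesic_def using cayley_walk_append[OF xs(1) ys(1)] xs(2) ys(2) e by simp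
  moreover have "p \<in> set (xs @ tl ys)" using xs(1) unfolding cayley_walk_def by auto
  ultimately show ?thesis by blast
qed

end

section \<open>From the given definitions to the abstract setting\<close>

lemma hyperbolic_hyp_group:
  assumes "hyperbolic_group G S"
  shows "\<exists>\<delta>. hyp_group G (\<lambda>x y. real (word_dist G S x y)) \<delta>"
proof -
  have G: "group G" and S: "symmetric_generating_set G S"
    using assms unfolding hyperbolic_group_def by auto
  interpret group G by (rule G)
  obtain \<delta> where d0: "\<delta> \<ge> 0" and d: "\<forall>w\<in>carrier G. \<forall>x\<in>carrier G. \<forall>y\<in>carrier G. \<forall>z\<in>carrier G.
        gromov_product G S w x y \<ge> min (gromov_product G S w x z) (gromov_product G S w z y) - \<delta>"
    using assms unfolding hyperbolic_group_def by blast
  have "hyp_group G (\<lambda>x y. real (word_dist G S x y)) \<delta>"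
  proof
    show "real (word_dist G S x x) = 0" if "x \<in> carrier G" for x
      using word_dist_le[OF G S, of 0 x x] that by (simp add: reach_0)
    show "\<exists>n. real (word_dist G S x y) = real n" for x y by blast
    show "real (word_dist G S x y) = real (word_dist G S y x)"
      if "x \<in> carrier G" "y \<in> carrier G" for x y using word_dist_sym[OF G S that] by simp
    show "real (word_dist G S x z) \<le> real (word_dist G S x y) + real (word_dist G S y z)"
      if "x \<in> carrier G" "y \<in> carrier G" "z \<in> carrier G" for x y z
      using word_dist_tri[OF G S that] by linarith
    show "real (word_dist G S (a \<otimes>\<^bsub>G\<^esub> x) (a \<otimes>\<^bsub>G\<^esub> y)) = real (word_dist G S x y)"
      if "a \<in> carrier G" "x \<in> carrier G" "y \<in> carrier G" for a x y
      using word_dist_left[OF G S that] by simp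
    show "finite {x \<in> carrier G. real (word_dist G S \<one>\<^bsub>G\<^esub> x) \<le> r}" for r
      by (rule finite_word_ball[OF G S])
    show "\<exists>p\<in>carrier G. real (word_dist G S x p) = real n \<and>
        real (word_dist G S p y) = real (word_dist G S x y) - real n"
      if "x \<in> carrier G" "y \<in> carrier G" "real n \<le> real (word_dist G S x y)" for x y n
      using word_dist_geod[OF G S that(1,2), of n] that(3) by (auto simp: of_nat_diff)
    show "0 \<le> \<delta>" by (rule d0)
    show "min ((real (word_dist G S w x) + real (word_dist G S w z) - real (word_dist G S x z)) / 2)
          ((real (word_dist G S w z) + real (word_dist G S w y) - real (word_dist G S z y)) / 2) - \<delta>
        \<le> (real (word_dist G S w x) + real (word_dist G S w y) - real (word_dist G S x y)) / 2"
      if "w \<in> carrier G" "x \<in> carrier G" "y \<in> carrier G" "z \<in> carrier G" for w x y z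
      using bspec[OF bspec[OF bspec[OF bspec[OF d that(1)] that(2)] that(3)] that(4)]
        word_dist_sym[OF G S that(1) that(2)] word_dist_sym[OF G S that(1) that(3)]
        word_dist_sym[OF G S that(1) that(4)]
      unfolding gromov_product_def by simp
  qed
  then show ?thesis by blast
qed

text \<open>If \<open>a\<close> in \<open>H\<close> has the form
  \<open>e \<otimes> f \<otimes> t\<close>, its right coset is exactly the set \<open>X t\<close>.
  It depends on \<open>t\<close> alone, so there are at most as many cosets as elements of
  \<open>T\<close>. The contrapositive turns the index hypothesis into \<open>thin\<close>.\<close>

lemma finite_index_if_covered:
  assumes G: "group G" and H: "subgroup H G" and F: "subgroup F G" and e: "e \<in> carrier G"
    and T: "finite T" "T \<subseteq> carrier G" and cover: "H \<subseteq> (e <#\<^bsub>G\<^esub> F) <#>\<^bsub>G\<^esub> T"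
  shows "\<not> infinite_index G H (H \<inter> conjugate_set G e F)"
proof -
  interpret group G by (rule G)
  define X where "X t = H \<inter> (\<lambda>f. e \<otimes>\<^bsub>G\<^esub> f \<otimes>\<^bsub>G\<^esub> t) ` F" for t
  have Fc: "f \<in> carrier G" if "f \<in> F" for f by (rule subgroup.mem_carrier[OF F that])
  have Hc: "h \<in> carrier G" if "h \<in> H" for h by (rule subgroup.mem_carrier[OF H that])
  have conj: "conjugate_set G e F = (\<lambda>f. e \<otimes>\<^bsub>G\<^esub> f \<otimes>\<^bsub>G\<^esub> inv\<^bsub>G\<^esub> e) ` F"
    unfolding conjugate_set_def l_coset_def r_coset_def by auto
  have "(\<lambda>h. h \<otimes>\<^bsub>G\<^esub> a) ` (H \<inter> conjugate_set G e F) \<in> X ` T" if a: "a \<in> H" for a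
  proof -
    obtain f t where f: "f \<in> F" and t: "t \<in> T" and aeq: "a = e \<otimes>\<^bsub>G\<^esub> f \<otimes>\<^bsub>G\<^esub> t"
      using subsetD[OF cover a] unfolding set_mult_def l_coset_def by blast
    have tc [simp]: "t \<in> carrier G" and [simp]: "f \<in> carrier G" "e \<in> carrier G" using t T f Fc e by auto
    have "(\<lambda>h. h \<otimes>\<^bsub>G\<^esub> a) ` (H \<inter> conjugate_set G e F) = X t"
    proof
      show "(\<lambda>h. h \<otimes>\<^bsub>G\<^esub> a) ` (H \<inter> conjugate_set G e F) \<subseteq> X t"
      proof (rule image_subsetI)
        fix h assume "h \<in> H \<inter> conjugate_set G e F"
        then obtain k where k: "h \<in> H" "k \<in> F" "h = e \<otimes>\<^bsub>G\<^esub> k \<otimes>\<^bsub>G\<^esub> inv\<^bsub>G\<^esub> e" unfolding conj by blast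
        have "h \<otimes>\<^bsub>G\<^esub> a = e \<otimes>\<^bsub>G\<^esub> (k \<otimes>\<^bsub>G\<^esub> f) \<otimes>\<^bsub>G\<^esub> t"
          using k Fc unfolding aeq by (simp add: m_assoc)
        moreover have "k \<otimes>\<^bsub>G\<^esub> f \<in> F" by (rule subgroup.m_closed[OF F k(2) f])
        moreover have "h \<otimes>\<^bsub>G\<^esub> a \<in> H" by (rule subgroup.m_closed[OF H k(1) a])
        ultimately show "h \<otimes>\<^bsub>G\<^esub> a \<in> X t" unfolding X_def by blast
      qed
      show "X t \<subseteq> (\<lambda>h. h \<otimes>\<^bsub>G\<^esub> a) ` (H \<inter> conjugate_set G e F)"
      proof
        fix x assume "x \<in> X t"
        then obtain k where k: "x \<in> H" "k \<in> F" "x = e \<otimes>\<^bsub>G\<^esub> k \<otimes>\<^bsub>G\<^esub> t" unfolding X_def by blast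
        have [simp]: "k \<in> carrier G" using k Fc by simp
        define h where "h = x \<otimes>\<^bsub>G\<^esub> inv\<^bsub>G\<^esub> a"
        have "h \<in> H" unfolding h_def
          by (rule subgroup.m_closed[OF H k(1) subgroup.m_inv_closed[OF H a]])
        moreover have "h = e \<otimes>\<^bsub>G\<^esub> (k \<otimes>\<^bsub>G\<^esub> inv\<^bsub>G\<^esub> f) \<otimes>\<^bsub>G\<^esub> inv\<^bsub>G\<^esub> e"
          unfolding h_def k(3) aeq by (simp add: m_assoc inv_mult_group)
        moreover have "k \<otimes>\<^bsub>G\<^esub> inv\<^bsub>G\<^esub> f \<in> F"
          by (rule subgroup.m_closed[OF F k(2) subgroup.m_inv_closed[OF F f]])
        moreover have "x = h \<otimes>\<^bsub>G\<^esub> a" unfolding h_def using Hc[OF a] Hc[OF k(1)] by (simp add: m_assoc)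
        ultimately show "x \<in> (\<lambda>h. h \<otimes>\<^bsub>G\<^esub> a) ` (H \<inter> conjugate_set G e F)" unfolding conj by blast
      qed
    qed
    then show ?thesis using t by blast
  qed
  then have "rcosets\<^bsub>G\<lparr>carrier := H\<rparr>\<^esub> (H \<inter> conjugate_set G e F) \<subseteq> X ` T"
    unfolding RCOSETS_def r_coset_def by (auto simp: UNION_singleton_eq_range)
  then show ?thesis unfolding infinite_index_def using T(1) finite_subset by blast
qed

theorem theorem3:
  fixes G :: "('a, 'b) monoid_scheme"
    and S H Q P1 P2 :: "'a set"
    and Ps :: "'a product_rep list"
  assumes "hyperbolic_group G S"
    and "subgroup H G"
    and "\<forall>P\<in>set Ps. is_quasiconvex_product G S P"
    and "Q = (\<Union>P\<in>set Ps. product_set G P)"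
    and "\<forall>g\<in>carrier G. \<forall>F\<in>(\<Union>P\<in>set Ps. product_members P).
           infinite_index G H (H \<inter> conjugate_set G g F)"
    and "finite P1" and "P1 \<subseteq> carrier G"
    and "finite P2" and "P2 \<subseteq> carrier G"
  shows "\<not> H \<subseteq> P1 <#>\<^bsub>G\<^esub> set_inv\<^bsub>G\<^esub> Q <#>\<^bsub>G\<^esub> Q <#>\<^bsub>G\<^esub> P2"
proof
  assume sub: "H \<subseteq> P1 <#>\<^bsub>G\<^esub> set_inv\<^bsub>G\<^esub> Q <#>\<^bsub>G\<^esub> Q <#>\<^bsub>G\<^esub> P2"
  have G: "group G" and S: "symmetric_generating_set G S"
    using assms(1) unfolding hyperbolic_group_def by auto
  obtain \<delta> where hg: "hyp_group G (\<lambda>x y. real (word_dist G S x y)) \<delta>"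
    using hyperbolic_hyp_group[OF assms(1)] by blast
  interpret hyp_group G "\<lambda>x y. real (word_dist G S x y)" \<delta> by (rule hg)
  define \<F> where "\<F> = (\<Union>P\<in>set Ps. product_members P)"
  have fin: "finite \<F>" unfolding \<F>_def product_members_def by auto
  have FF: "subgroup F G \<and> quasiconvex G S F" if FF: "F \<in> \<F>" for F
  proof -
    obtain P g where "P \<in> set Ps" "(F, g) \<in> set (snd P)"
      using FF unfolding \<F>_def product_members_def by force
    then show ?thesis using assms(3) unfolding is_quasiconvex_product_def by blast
  qed
  \<comment> \<open>The unit of \<open>H\<close> would lie in the product, so \<open>Q\<close> is
    nonempty; as every quasiconvex product has a factor, there is at least one member.\<close>
  have "Q \<noteq> {}" using sub subgroup.one_closed[OF assms(2)] unfolding set_mult_def by auto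
  then obtain P where P: "P \<in> set Ps" unfolding assms(4) by blast
  then have "snd P \<noteq> []" using assms(3) unfolding is_quasiconvex_product_def by blast
  then have ne: "\<F> \<noteq> {}" using P unfolding \<F>_def product_members_def by auto
  have "\<forall>F\<in>\<F>. \<exists>\<eta>::real. \<eta> \<ge> 0 \<and> (\<forall>x\<in>F. \<forall>y\<in>F. \<forall>xs. cayley_geodesic G S x xs y \<longrightarrow>
      (\<forall>p\<in>set xs. \<exists>a\<in>F. real (word_dist G S p a) \<le> \<eta>))"
    using FF unfolding quasiconvex_def by blast
  from bchoice[OF this] obtain h :: "'a set \<Rightarrow> real"
    where h: "\<forall>F\<in>\<F>. h F \<ge> 0 \<and> (\<forall>x\<in>F. \<forall>y\<in>F. \<forall>xs. cayley_geodesic G S x xs y \<longrightarrow>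
      (\<forall>p\<in>set xs. \<exists>a\<in>F. real (word_dist G S p a) \<le> h F))" by (elim exE) (rule that; assumption)
  \<comment> \<open>A sum of nonnegative constants serves as a common bound without a maximum over a
    possibly empty set; \<open>D\<close> below is formed in the same way.\<close>
  define \<eta> where "\<eta> = (\<Sum>F\<in>\<F>. h F)"
  have h_le: "h F \<le> \<eta>" if "F \<in> \<F>" for F
    unfolding \<eta>_def using that fin h by (intro member_le_sum) auto
  have \<eta>0: "\<eta> \<ge> 0" unfolding \<eta>_def using h by (intro sum_nonneg) auto
  have Fs: "\<forall>F\<in>\<F>. qc \<eta> F"
  proof
    fix F assume F: "F \<in> \<F>"
    have sF: "subgroup F G" using FF[OF F] by simp
    have "\<exists>a\<in>F. real (word_dist G S p a) \<le> \<eta>"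
      if x: "x \<in> F" and y: "y \<in> F" and p: "p \<in> carrier G"
        and e: "real (word_dist G S x p) + real (word_dist G S p y) = real (word_dist G S x y)" for x y p
    proof -
      have c: "x \<in> carrier G" "y \<in> carrier G" using x y subgroup.mem_carrier[OF sF] by auto
      have "word_dist G S x p + word_dist G S p y = word_dist G S x y" using e by linarith
      then obtain xs where "cayley_geodesic G S x xs y" "p \<in> set xs"
        using geodesic_through[OF G S c(1) p c(2)] by blast
      then obtain a where "a \<in> F" "real (word_dist G S p a) \<le> h F" using bspec[OF h F] x y by blast
      then show ?thesis using h_le[OF F] by force
    qed
    then show "qc \<eta> F" unfolding qc_def using sF by blast
  qed
  have thin: "thin H \<F>"
    unfolding thin_def
  proof (intro ballI allI impI notI)
    fix e F T
    assume e: "e \<in> carrier G" and F: "F \<in> \<F>" and T: "finite T" "T \<subseteq> carrier G"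
      and c: "H \<subseteq> (e <#\<^bsub>G\<^esub> F) <#>\<^bsub>G\<^esub> T"
    have "\<not> infinite_index G H (H \<inter> conjugate_set G e F)"
      using finite_index_if_covered[OF G assms(2) _ e T c] FF[OF F] by simp
    then show False using assms(5) e F unfolding \<F>_def by blast
  qed
  \<comment> \<open>All factors that do not come from members: the translating elements of the
    products and the two finite sets. They fit into one ball, of radius \<open>D\<close>.\<close>
  define Z where "Z = fst ` set Ps \<union> (\<Union>P\<in>set Ps. snd ` set (snd P)) \<union> P1 \<union> P2"
  have Zf: "finite Z" unfolding Z_def using assms by auto
  have Zc: "Z \<subseteq> carrier G"
  proof -
    have "fst P \<in> carrier G \<and> snd ` set (snd P) \<subseteq> carrier G" if "P \<in> set Ps" for P
      using bspec[OF assms(3) that] unfolding is_quasiconvex_product_def by (auto simp: case_prod_beta)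
    then show ?thesis unfolding Z_def using assms(7,9) by blast
  qed
  define D where "D = (\<Sum>z\<in>Z. real (word_dist G S \<one>\<^bsub>G\<^esub> z))"
  have D0: "D \<ge> 0" unfolding D_def by (intro sum_nonneg) auto
  define U where "U = \<Union>\<F> \<union> {y \<in> carrier G. real (word_dist G S \<one>\<^bsub>G\<^esub> y) \<le> D}"
  have ZU: "Z \<subseteq> U"
  proof
    fix z assume z: "z \<in> Z"
    have "real (word_dist G S \<one>\<^bsub>G\<^esub> z) \<le> D" unfolding D_def using z Zf by (intro member_le_sum) auto
    then show "z \<in> U" unfolding U_def using z Zc by blast
  qed
  have Uc: "U \<subseteq> carrier G" unfolding U_def using FF subgroup.subset by blast
  have Ui: "inv\<^bsub>G\<^esub> u \<in> U" if u: "u \<in> U" for u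
  proof (cases "u \<in> \<Union>\<F>")
    case True
    then obtain F where F: "F \<in> \<F>" "u \<in> F" by blast
    then have "inv\<^bsub>G\<^esub> u \<in> F" using FF[OF F(1)] by (simp add: subgroup.m_inv_closed)
    then show ?thesis unfolding U_def using F(1) by blast
  next
    case False
    then show ?thesis using u d_inv[of u] unfolding U_def by simp
  qed
  have U1: "\<one>\<^bsub>G\<^esub> \<in> U" unfolding U_def using D0 d_refl[of "\<one>\<^bsub>G\<^esub>"] by simp
  \<comment> \<open>One factor for the leading element and two for each pair of a member and its
    translating element; summing over all products gives a uniform count, and shorter products are
    padded with units.\<close>
  define N where "N = 1 + 2 * (\<Sum>P\<in>set Ps. length (snd P))"
  have QN: "Q \<subseteq> prod_pow U N"
    unfolding assms(4)
  proof (rule UN_least)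
    fix P assume P: "P \<in> set Ps"
    have fs: "\<forall>(F, g)\<in>set (snd P). F \<subseteq> U \<and> g \<in> U"
    proof (rule ballI, rule case_prodI2, rule conjI)
      fix Fg F g assume eq: "Fg = (F, g)" and "Fg \<in> set (snd P)"
      then have Fg: "(F, g) \<in> set (snd P)" by simp
      have "F \<in> \<F>" using P Fg unfolding \<F>_def product_members_def by force
      then show "F \<subseteq> U" unfolding U_def by blast
      have "g \<in> Z" using P Fg unfolding Z_def by force
      then show "g \<in> U" using ZU by blast
    qed
    have "{fst P} \<subseteq> prod_pow U (Suc 0)"
      using prod_pow_one[OF Uc, of "fst P"] ZU P unfolding Z_def by blast
    then have "product_set G P \<subseteq> prod_pow U (Suc 0 + 2 * length (snd P))"
      unfolding product_set_def by (rule foldl_product_prod_pow[OF Uc fs])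
    moreover have "length (snd P) \<le> (\<Sum>P\<in>set Ps. length (snd P))"
      by (rule member_le_sum[OF P]) auto
    ultimately show "product_set G P \<subseteq> prod_pow U N"
      using prod_pow_mono[OF Uc U1, of "Suc 0 + 2 * length (snd P)" N] unfolding N_def by simp
  qed
  have "H \<subseteq> prod_pow U (Suc 0 + N + N + Suc 0)"
  proof
    fix x assume "x \<in> H"
    then obtain p q q' p' where x: "x = p \<otimes>\<^bsub>G\<^esub> inv\<^bsub>G\<^esub> q \<otimes>\<^bsub>G\<^esub> q' \<otimes>\<^bsub>G\<^esub> p'"
      and m: "p \<in> P1" "q \<in> Q" "q' \<in> Q" "p' \<in> P2"
      using sub unfolding set_mult_def SET_INV_def by blast
    have "p \<in> prod_pow U (Suc 0)" "p' \<in> prod_pow U (Suc 0)"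
      using m ZU unfolding Z_def by (auto intro!: prod_pow_one[OF Uc] simp del: prod_pow.simps)
    moreover have "inv\<^bsub>G\<^esub> q \<in> prod_pow U N" "q' \<in> prod_pow U N"
      using prod_pow_inv[OF Uc Ui] QN m by auto
    ultimately show "x \<in> prod_pow U (Suc 0 + N + N + Suc 0)"
      unfolding x by (intro prod_pow_mult[OF Uc])
  qed
  then show False
    using thin_not_subset_prod_pow[OF assms(2) Fs ne fin thin D0 \<eta>0] unfolding U_def by blast
qed

end
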